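(* Let $G$ be a finite group, let $n\geqslant 2$, and let $V$ be a non-trivial $\mathfrak S_n$-spherical irreducible representation of $W_n(G)$. Then there is an element $$w=\sum_{1\leqslant i<j\leqslant n}\mathsf a_{ij}(ij)+\sum_{g\in G^n}\mathsf c_g\,g\in\mathbb R[W_n(G)],\qquad \mathsf a_{ij}\geqslant 0,\quad \mathsf c_g=\mathsf c_{g^{-1}}\geqslant 0,$$ such that, for every irreducible representation $U$ of $W_n(G)$, the equality $\psi_{W_n(G)}(w,U)=\psi_{W_n(G)}(w)$ holds if and only if $U\cong V$ or $U\cong V^*$.
   Context: $W_n(G)=G\wr\mathfrak S_n=G^n\rtimes\mathfrak S_n$ with multiplication $(g;\pi)(h;\sigma)=(g(\pi\cdot h);\pi\sigma)$, $\pi\cdot g=(g_{\pi^{-1}(1)},\dots,g_{\pi^{-1}(n)})$; $G^n$ and $\mathfrak S_n$ are regarded as subgroups, and $(ij)$ is the transposition. All representations are finite-dimensional, complex and unitary; $V^*$ denotes the contragredient (dual) representation. An irreducible representation $V$ of $W_n(G)$ is $\mathfrak S_n$-spherical if it has a non-zero $\mathfrak S_n$-fixed vector. For a finite group $H$ and $w=\sum_h\mathsf c_h h\in\mathbb R[H]$ with $\mathsf c_h=\mathsf c_{h^{-1}}\geqslant 0$, put $\Delta_H(w)=\sum_h\mathsf c_h(1_H-h)$. For a representation $V$ of $H$, $\psi_H(w,V)$ is the smallest eigenvalue of $\Delta_H(w)$ on $(V^H)^\perp$, where $V^H$ is the fixed subspace, with $\psi_H(w,V)=+\infty$ if $V=V^H$.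 Put $\psi_H(w)=\psi_H(w,\mathrm{Reg}_H)$, with $\mathrm{Reg}_H$ the regular representation. *)

theory Defs
  imports
    "HOL-Algebra.Sym_Groups"
    "HOL-Algebra.Product_Groups"
    "HOL-Library.Extended_Real"
    "Jordan_Normal_Form.VS_Connect"
    "Jordan_Normal_Form.Schur_Decomposition"
begin

section \<open>The wreath product\<close>

text \<open>Permutations multiply by composition, so \<open>(\<pi> \<cdot> g) i = g (inv' \<pi> i)\<close> defines a left action.\<close>

definition base_group :: "nat \<Rightarrow> 'g monoid \<Rightarrow> (nat \<Rightarrow> 'g) monoid" where
  "base_group n G = product_group {1..n} (\<lambda>_. G)"

definition perm_act :: "nat \<Rightarrow> (nat \<Rightarrow> nat) \<Rightarrow> (nat \<Rightarrow> 'g) \<Rightarrow> (nat \<Rightarrow> 'g)" where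
  "perm_act n \<pi> g = (\<lambda>i\<in>{1..n}. g (inv' \<pi> i))"

definition wreath :: "nat \<Rightarrow> 'g monoid \<Rightarrow> ((nat \<Rightarrow> 'g) \<times> (nat \<Rightarrow> nat)) monoid" where
  "wreath n G =
    \<lparr> carrier = carrier (base_group n G) \<times> carrier (sym_group n),
      mult = (\<lambda>(g, \<pi>) (h, \<sigma>).
        (g \<otimes>\<^bsub>base_group n G\<^esub> perm_act n \<pi> h, \<pi> \<otimes>\<^bsub>sym_group n\<^esub> \<sigma>)),
      one = (\<one>\<^bsub>base_group n G\<^esub>, \<one>\<^bsub>sym_group n\<^esub>) \<rparr>"

definition base_emb :: "nat \<Rightarrow> (nat \<Rightarrow> 'g) \<Rightarrow> (nat \<Rightarrow> 'g) \<times> (nat \<Rightarrow> nat)" where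
  "base_emb n g = (g, \<one>\<^bsub>sym_group n\<^esub>)"

definition perm_emb :: "nat \<Rightarrow> 'g monoid \<Rightarrow> (nat \<Rightarrow> nat) \<Rightarrow> (nat \<Rightarrow> 'g) \<times> (nat \<Rightarrow> nat)" where
  "perm_emb n G \<pi> = (\<one>\<^bsub>base_group n G\<^esub>, \<pi>)"


section \<open>Unitary representations\<close>

text \<open>A finite-dimensional unitary representation is given, after the choice of an orthonormal
  basis, by a dimension \<open>d\<close> and a homomorphism \<open>\<rho>\<close> into the unitary \<open>d \<times> d\<close> matrices; the
  underlying space is \<open>carrier_vec d\<close>.  The values of \<open>\<rho>\<close> outside \<open>carrier H\<close> are irrelevant.\<close>

definition unitary_group :: "nat \<Rightarrow> complex mat monoid" where
  "unitary_group d =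
    \<lparr> carrier = {A \<in> carrier_mat d d. A * mat_adjoint A = 1\<^sub>m d \<and> mat_adjoint A * A = 1\<^sub>m d},
      mult = (*), one = 1\<^sub>m d \<rparr>"

definition unitary_rep :: "'h monoid \<Rightarrow> nat \<Rightarrow> ('h \<Rightarrow> complex mat) \<Rightarrow> bool" where
  "unitary_rep H d \<rho> \<longleftrightarrow> \<rho> \<in> hom H (unitary_group d)"

definition irreducible_rep :: "'h monoid \<Rightarrow> nat \<Rightarrow> ('h \<Rightarrow> complex mat) \<Rightarrow> bool" where
  "irreducible_rep H d \<rho> \<longleftrightarrow>
    unitary_rep H d \<rho> \<and> 0 < d \<and>
    (\<forall>W. VectorSpace.subspace class_ring W (module_vec TYPE(complex) d) \<longrightarrow>
         (\<forall>h\<in>carrier H. \<forall>v\<in>W. \<rho> h *\<^sub>v v \<in> W) \<longrightarrow>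
         W = {0\<^sub>v d} \<or> W = carrier_vec d)"

definition rep_iso ::
  "'h monoid \<Rightarrow> nat \<Rightarrow> ('h \<Rightarrow> complex mat) \<Rightarrow> nat \<Rightarrow> ('h \<Rightarrow> complex mat) \<Rightarrow> bool" where
  "rep_iso H d \<rho> d' \<rho>' \<longleftrightarrow>
    (\<exists>T\<in>carrier_mat d' d. invertible_mat T \<and> (\<forall>h\<in>carrier H. T * \<rho> h = \<rho>' h * T))"

definition dual_rep :: "'h monoid \<Rightarrow> ('h \<Rightarrow> complex mat) \<Rightarrow> 'h \<Rightarrow> complex mat" where
  "dual_rep H \<rho> h = transpose_mat (\<rho> (inv\<^bsub>H\<^esub> h))"

definition trivial_rep :: "'h \<Rightarrow> complex mat" where
  "trivial_rep h = 1\<^sub>m 1"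

text \<open>The regular representation has basis \<open>carrier H\<close>, on which \<open>h\<close> acts by left multiplication.
  Its matrices refer to an arbitrary but fixed enumeration of that basis.\<close>

definition elem_enum :: "'h monoid \<Rightarrow> nat \<Rightarrow> 'h" where
  "elem_enum H = (SOME e. bij_betw e {0..<Coset.order H} (carrier H))"

definition reg_rep :: "'h monoid \<Rightarrow> 'h \<Rightarrow> complex mat" where
  "reg_rep H h =
    mat (Coset.order H) (Coset.order H)
      (\<lambda>(i, j). if elem_enum H i = h \<otimes>\<^bsub>H\<^esub> elem_enum H j then 1 else 0)"

definition fixed_space ::
  "'h set \<Rightarrow> nat \<Rightarrow> ('h \<Rightarrow> complex mat) \<Rightarrow> complex vec set" where
  "fixed_space K d \<rho> = {v \<in> carrier_vec d. \<forall>h\<in>K. \<rho> h *\<^sub>v v = v}"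

definition orth_compl :: "nat \<Rightarrow> complex vec set \<Rightarrow> complex vec set" where
  "orth_compl d W = {v \<in> carrier_vec d. \<forall>u\<in>W. v \<bullet>c u = 0}"

definition sym_spherical ::
  "nat \<Rightarrow> 'g monoid \<Rightarrow> nat \<Rightarrow> ((nat \<Rightarrow> 'g) \<times> (nat \<Rightarrow> nat) \<Rightarrow> complex mat) \<Rightarrow> bool" where
  "sym_spherical n G d \<rho> \<longleftrightarrow>
    (\<exists>v \<in> fixed_space (perm_emb n G ` carrier (sym_group n)) d \<rho>. v \<noteq> 0\<^sub>v d)"


section \<open>The real group algebra and spectral gaps\<close>

text \<open>An element \<open>\<Sum>\<^sub>h c\<^sub>h h\<close> of the real group algebra of a finite group \<open>H\<close> is represented by its
  coefficient function; only its values on \<open>carrier H\<close> matter.\<close>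

definition ga_basis :: "'h \<Rightarrow> 'h \<Rightarrow> real" where
  "ga_basis h = (\<lambda>x. if x = h then 1 else 0)"

definition ga_Delta :: "'h monoid \<Rightarrow> ('h \<Rightarrow> real) \<Rightarrow> 'h \<Rightarrow> real" where
  "ga_Delta H w = (\<lambda>x. \<Sum>h\<in>carrier H. w h * (ga_basis \<one>\<^bsub>H\<^esub> x - ga_basis h x))"

definition ga_rep ::
  "'h monoid \<Rightarrow> nat \<Rightarrow> ('h \<Rightarrow> complex mat) \<Rightarrow> ('h \<Rightarrow> real) \<Rightarrow> complex mat" where
  "ga_rep H d \<rho> w =
    mat d d (\<lambda>(i, j). \<Sum>h\<in>carrier H. complex_of_real (w h) * \<rho> h $$ (i, j))"

text \<open>For symmetric \<open>w\<close> the operator \<open>\<Delta>\<^sub>H(w)\<close> is Hermitian, so all its eigenvalues are real.\<close>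

definition psi ::
  "'h monoid \<Rightarrow> ('h \<Rightarrow> real) \<Rightarrow> nat \<Rightarrow> ('h \<Rightarrow> complex mat) \<Rightarrow> ereal" where
  "psi H w d \<rho> =
    (if fixed_space (carrier H) d \<rho> = carrier_vec d then \<infinity>
     else ereal (Min {l. \<exists>v \<in> orth_compl d (fixed_space (carrier H) d \<rho>).
            eigenvector (ga_rep H d \<rho> (ga_Delta H w)) v (complex_of_real l)}))"

definition psi_reg :: "'h monoid \<Rightarrow> ('h \<Rightarrow> real) \<Rightarrow> ereal" where
  "psi_reg H w = psi H w (Coset.order H) (reg_rep H)"

text \<open>The element \<open>\<Sum>\<^bsub>1 \<le> i < j \<le> n\<^esub> a\<^sub>i\<^sub>j (i j) + \<Sum>\<^bsub>g \<in> G\<^sup>n\<^esub> c\<^sub>g g\<close> of the group algebra of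
  \<open>wreath n G\<close>.\<close>

definition wreath_element ::
  "nat \<Rightarrow> 'g monoid \<Rightarrow> (nat \<Rightarrow> nat \<Rightarrow> real) \<Rightarrow> ((nat \<Rightarrow> 'g) \<Rightarrow> real)
    \<Rightarrow> (nat \<Rightarrow> 'g) \<times> (nat \<Rightarrow> nat) \<Rightarrow> real" where
  "wreath_element n G a c = (\<lambda>x.
    (\<Sum>(i, j) \<in> {(i, j). 1 \<le> i \<and> i < j \<and> j \<le> n}.
        a i j * ga_basis (perm_emb n G (Transposition.transpose i j)) x) +
    (\<Sum>g\<in>carrier (base_group n G). c g * ga_basis (base_emb n g) x))"

end

theory Submission
  imports Defs "Jordan_Normal_Form.Spectral_Radius" "HOL-Analysis.L2_Norm"
begin

text \<open>Let \<open>v\<close> be a non-zero \<open>S\<close>-fixed vector of \<open>V\<close> and \<open>r g = Re \<langle>g v, v\<rangle>\<close>, a real function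
  invariant under inversion and bi-invariant under \<open>S\<close>.  Take \<open>c\<^sub>g = |v|\<^sup>2 + r g\<close> and let all \<open>a\<^sub>i\<^sub>j\<close> be a large
  constant \<open>M\<close>, so that low eigenvectors of \<open>\<Delta>\<close> are nearly \<open>S\<close>-fixed.  On an \<open>S\<close>-fixed vector \<open>u\<close>, the
  sum of \<open>c\<^sub>g \<langle>g u, u\<rangle>\<close> over \<open>G\<^sup>n\<close> is a multiple of the corresponding sum over the whole group, and by
  Schur orthogonality the latter vanishes unless some intertwiner to \<open>V\<close> or \<open>V\<^sup>*\<close> does not kill \<open>u\<close>.
  Hence, for \<open>M\<close> large, every eigenvalue outside the \<open>V\<close>- and \<open>V\<^sup>*\<close>-isotypic parts exceeds \<open>T - \<kappa>\<close>, where
  \<open>T = \<Sum> c\<^sub>g\<close> and \<open>\<kappa> = \<Sum> (r g)\<^sup>2 / |v|\<^sup>2\<close>, whereas the Rayleigh quotient at \<open>v\<close> equals \<open>T - \<kappa>\<close>.  Since \<open>\<Delta>\<close> is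
  real, \<open>V\<close> and \<open>V\<^sup>*\<close> have the same eigenvalues.\<close>

section \<open>Hermitian matrices\<close>

text \<open>The statement quantifies over all \<open>U\<close>, so \<open>M\<close> must be fixed
  before \<open>U\<close> is known. Hence the bound expressing that a vector nearly fixed by the
  generators is nearly fixed by all of \<open>S\<close> carries a constant \<open>N\<close> that is
  uniform over all unitary representations; completing a square then asks for
  \<open>M = (T N)\<^sup>2 / \<kappa>\<close>. No decomposition into irreducibles is carried out.
  Every estimate concerns a single eigenvector \<open>u\<close> of an arbitrary unitary
  representation, and membership in the isotypic parts is replaced by the existence of an
  intertwiner into \<open>V\<close> or \<open>V\<^sup>*\<close> that does not kill \<open>u\<close>.
  One statement therefore serves both an irreducible \<open>U\<close> and the regular
  representation. The dual enters because the coefficients have to be real: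
  \<open>Re \<langle>g v, v\<rangle>\<close> mixes the matrix coefficients of \<open>V\<close> and
  \<open>V\<^sup>*\<close>. The level \<open>T - \<kappa>\<close> is a threshold only; the exact
  bottom of the spectrum of \<open>V\<close> is never computed.\<close>

definition vnorm :: "complex vec \<Rightarrow> real" where
  "vnorm v = L2_set (\<lambda>i. cmod (v $ i)) {0..<dim_vec v}"

lemma vnorm_nonneg: "0 \<le> vnorm v"
  unfolding vnorm_def by (rule L2_set_nonneg)

lemma cscalar_prod_self: "v \<bullet>c v = complex_of_real ((vnorm v)\<^sup>2)"
proof -
  have "v \<bullet>c v = (\<Sum>i = 0..<dim_vec v. complex_of_real ((cmod (v $ i))\<^sup>2))"
    unfolding scalar_prod_def by (auto intro!: sum.cong simp: complex_norm_square[symmetric])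
  also have "\<dots> = complex_of_real ((vnorm v)\<^sup>2)"
    unfolding vnorm_def L2_set_def by (simp add: sum_nonneg)
  finally show ?thesis .
qed

lemma vnorm_pos_iff:
  assumes "v \<in> carrier_vec d"
  shows "0 < vnorm v \<longleftrightarrow> v \<noteq> 0\<^sub>v d"
proof -
  have "vnorm v = 0 \<longleftrightarrow> v = 0\<^sub>v d"
    using conjugate_square_eq_0_vec[OF assms] by (simp add: cscalar_prod_self)
  then show ?thesis using vnorm_nonneg[of v] by linarith
qed

text \<open>Passing to the moduli of the coordinates reduces this, and the triangle inequality
  below, to the corresponding facts on \<open>L2_set\<close>.\<close>

lemma cscalar_prod_Cauchy_Schwarz:
  assumes "u \<in> carrier_vec d" "v \<in> carrier_vec d"
  shows "cmod (u \<bullet>c v) \<le> vnorm u * vnorm v"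
proof -
  have "cmod (u \<bullet>c v) \<le> (\<Sum>i = 0..<d. \<bar>cmod (u $ i)\<bar> * \<bar>cmod (v $ i)\<bar>)"
    unfolding scalar_prod_def using assms
    by (auto intro!: order.trans[OF norm_sum] sum_mono simp: norm_mult)
  also have "\<dots> \<le> vnorm u * vnorm v"
    unfolding vnorm_def
    using L2_set_mult_ineq[of "\<lambda>i. cmod (u $ i)" "\<lambda>i. cmod (v $ i)" "{0..<d}"] assms by simp
  finally show ?thesis .
qed

lemma vnorm_triangle_minus:
  assumes "u \<in> carrier_vec d" "v \<in> carrier_vec d" "w \<in> carrier_vec d"
  shows "vnorm (u - w) \<le> vnorm (u - v) + vnorm (v - w)"
proof -
  have "vnorm (u - w) \<le> L2_set (\<lambda>i. cmod ((u - v) $ i) + cmod ((v - w) $ i)) {0..<d}"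
    unfolding vnorm_def using assms
    by (auto intro!: L2_set_mono order.trans[OF _ norm_triangle_ineq])
  also have "\<dots> \<le> vnorm (u - v) + vnorm (v - w)"
    unfolding vnorm_def using assms L2_set_triangle_ineq by auto
  finally show ?thesis .
qed

lemma cscalar_prod_cnj:
  fixes u v :: "complex vec"
  assumes "u \<in> carrier_vec d" "v \<in> carrier_vec d"
  shows "cnj (u \<bullet>c v) = v \<bullet>c u"
  using assms unfolding scalar_prod_def by (auto simp: mult.commute)

lemma cscalar_prod_minus_left:
  fixes u v w :: "complex vec"
  assumes "u \<in> carrier_vec d" "v \<in> carrier_vec d" "w \<in> carrier_vec d"
  shows "(u - v) \<bullet>c w = u \<bullet>c w - v \<bullet>c w"
  using assms by (intro minus_scalar_prod_distrib) auto

lemma cscalar_prod_minus_right: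
  fixes u v w :: "complex vec"
  assumes "u \<in> carrier_vec d" "v \<in> carrier_vec d" "w \<in> carrier_vec d"
  shows "u \<bullet>c (v - w) = u \<bullet>c v - u \<bullet>c w"
  using assms unfolding scalar_prod_def by (simp add: right_diff_distrib sum_subtractf)

lemma cscalar_prod_smult_left:
  fixes u v :: "complex vec"
  assumes "u \<in> carrier_vec d" "v \<in> carrier_vec d"
  shows "(a \<cdot>\<^sub>v u) \<bullet>c v = a * (u \<bullet>c v)"
  using assms by simp

lemma cscalar_prod_smult_right:
  fixes u v :: "complex vec"
  assumes "u \<in> carrier_vec d" "v \<in> carrier_vec d"
  shows "u \<bullet>c (a \<cdot>\<^sub>v v) = cnj a * (u \<bullet>c v)"
  using assms unfolding scalar_prod_def by (simp add: sum_distrib_left mult_ac)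

lemma vec_minus_eq_zeroD:
  fixes u v :: "complex vec"
  assumes "u \<in> carrier_vec d" "v \<in> carrier_vec d" "u - v = 0\<^sub>v d"
  shows "u = v"
proof (rule eq_vecI)
  fix i assume "i < dim_vec v"
  then have "i < d" using assms by simp
  then have "(u - v) $ i = 0" by (simp add: assms(3))
  then show "u $ i = v $ i" using \<open>i < d\<close> assms(1,2) by simp
qed (use assms in auto)

lemma vec_eq_cscalar_prodI:
  fixes u v :: "complex vec"
  assumes "u \<in> carrier_vec d" "v \<in> carrier_vec d"
    and "\<And>w. w \<in> carrier_vec d \<Longrightarrow> u \<bullet>c w = v \<bullet>c w"
  shows "u = v"
proof -
  have "(u - v) \<bullet>c (u - v) = 0"
    using assms cscalar_prod_minus_left[of u d v "u - v"] by simp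
  then have "vnorm (u - v) = 0"
    by (simp add: cscalar_prod_self)
  then have "u - v = 0\<^sub>v d"
    using vnorm_pos_iff[of "u - v" d] assms by auto
  then show ?thesis
    by (rule vec_minus_eq_zeroD[OF assms(1,2)])
qed

lemma mat_eq_mult_vecI:
  assumes "A \<in> carrier_mat d e" "B \<in> carrier_mat d e"
    and "\<And>u. u \<in> carrier_vec e \<Longrightarrow> A *\<^sub>v u = B *\<^sub>v u"
  shows "(A :: complex mat) = B"
proof (rule eq_matI)
  fix i j assume "i < dim_row B" "j < dim_col B"
  then have ij: "i < d" "j < e" using assms by auto
  have "(A *\<^sub>v unit_vec e j) $ i = (B *\<^sub>v unit_vec e j) $ i"
    using assms by simp
  then show "A $$ (i, j) = B $$ (i, j)"
    using ij assms(1,2) by simp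
qed (use assms in auto)

lemma smult_mat_mult_vec:
  fixes A :: "complex mat"
  assumes "A \<in> carrier_mat d e" "u \<in> carrier_vec e"
  shows "(a \<cdot>\<^sub>m A) *\<^sub>v u = a \<cdot>\<^sub>v (A *\<^sub>v u)"
  using assms by (intro eq_vecI) (auto simp: scalar_prod_def sum_distrib_left mult_ac)

lemma mat_adjoint_carrier:
  "A \<in> carrier_mat d e \<Longrightarrow> mat_adjoint A \<in> carrier_mat e d"
  unfolding mat_adjoint_def mat_of_rows_def by auto

lemma mat_adjoint_index:
  fixes A :: "complex mat"
  assumes "A \<in> carrier_mat d e" "i < e" "j < d"
  shows "mat_adjoint A $$ (i, j) = cnj (A $$ (j, i))"
  using assms unfolding mat_adjoint_def by (auto simp: mat_of_rows_def)

lemma mat_adjoint_cscalar_prod: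
  fixes A :: "complex mat"
  assumes A: "A \<in> carrier_mat d e" and u: "u \<in> carrier_vec e" and w: "w \<in> carrier_vec d"
  shows "(A *\<^sub>v u) \<bullet>c w = u \<bullet>c (mat_adjoint A *\<^sub>v w)"
proof -
  have "(A *\<^sub>v u) \<bullet>c w = (\<Sum>i = 0..<d. \<Sum>j = 0..<e. A $$ (i, j) * u $ j * cnj (w $ i))"
    using assms unfolding scalar_prod_def by (auto simp: sum_distrib_right scalar_prod_def)
  also have "\<dots> = (\<Sum>j = 0..<e. \<Sum>i = 0..<d. A $$ (i, j) * u $ j * cnj (w $ i))"
    by (rule sum.swap)
  also have "\<dots> = u \<bullet>c (mat_adjoint A *\<^sub>v w)"
    using assms mat_adjoint_carrier[OF A] unfolding scalar_prod_def
    by (auto simp: sum_distrib_left scalar_prod_def mat_adjoint_index[OF A] mult_ac intro!: sum.cong)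
  finally show ?thesis .
qed

section \<open>Self-adjoint matrices: real spectrum and the bottom of the quadratic form\<close>

definition hermitian :: "nat \<Rightarrow> complex mat \<Rightarrow> bool" where
  "hermitian d A \<longleftrightarrow> A \<in> carrier_mat d d \<and>
    (\<forall>u\<in>carrier_vec d. \<forall>v\<in>carrier_vec d. (A *\<^sub>v u) \<bullet>c v = u \<bullet>c (A *\<^sub>v v))"

lemma hermitian_eigenvalue_real:
  assumes "hermitian d A" "eigenvector A v e"
  shows "e = complex_of_real (Re e)"
proof -
  have A: "A \<in> carrier_mat d d" using assms(1) by (simp add: hermitian_def)
  have v: "v \<in> carrier_vec d" "v \<noteq> 0\<^sub>v d" "A *\<^sub>v v = e \<cdot>\<^sub>v v"
    using assms(2) A by (auto simp: eigenvector_def)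
  have "e * (v \<bullet>c v) = cnj e * (v \<bullet>c v)"
    using assms(1) v(1) cscalar_prod_smult_left[OF v(1) v(1), of e]
      cscalar_prod_smult_right[OF v(1) v(1), of e]
    unfolding hermitian_def by (metis v(3))
  moreover have "v \<bullet>c v \<noteq> 0"
    using vnorm_pos_iff[of v d] v by (simp add: cscalar_prod_self)
  ultimately have "cnj e = e" by auto
  then show ?thesis by (metis Reals_cnj_iff of_real_Re)
qed

lemma pow_mat_add:
  assumes "A \<in> carrier_mat d d"
  shows "A ^\<^sub>m (j + k) = A ^\<^sub>m j * A ^\<^sub>m k"
proof (induction k)
  case (Suc k)
  then show ?case using assms by (simp add: assoc_mult_mat[of _ d d _ d _ d])
qed (use assms in simp)

text \<open>With \<open>x = B^m v\<close>, self-adjointness gives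
  \<open>\<langle>B^(2m) v, v\<rangle> = |x|\<^sup>2\<close>, and Cauchy-Schwarz bounds this below
  by the square of \<open>\<langle>B^m v, v\<rangle>\<close> because \<open>v\<close> is a unit
  vector. Each doubling of the exponent thus squares the bound.\<close>

lemma hermitian_power_growth:
  assumes herm: "hermitian d B" and v: "v \<in> carrier_vec d" "vnorm v = 1"
    and b: "0 \<le> b" "b \<le> Re ((B *\<^sub>v v) \<bullet>c v)"
  shows "b ^ (2 ^ k) \<le> Re ((B ^\<^sub>m (2 ^ k) *\<^sub>v v) \<bullet>c v)"
proof (induction k)
  case 0
  have "B \<in> carrier_mat d d" using herm by (simp add: hermitian_def)
  then show ?case using b by simp
next
  case (Suc k)
  have B: "B \<in> carrier_mat d d" using herm by (simp add: hermitian_def)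
  note P = pow_carrier_mat[OF B]
  have pow_herm: "(B ^\<^sub>m m *\<^sub>v x) \<bullet>c y = x \<bullet>c (B ^\<^sub>m m *\<^sub>v y)"
    if "x \<in> carrier_vec d" "y \<in> carrier_vec d" for m x y
    using that
  proof (induction m arbitrary: x y)
    case (Suc m)
    have "(B ^\<^sub>m Suc m *\<^sub>v x) \<bullet>c y = (B ^\<^sub>m m *\<^sub>v (B *\<^sub>v x)) \<bullet>c y"
      using assoc_mult_mat_vec[OF P B Suc.prems(1), of m] by simp
    also have "\<dots> = (B *\<^sub>v x) \<bullet>c (B ^\<^sub>m m *\<^sub>v y)"
      using Suc B by simp
    also have "\<dots> = x \<bullet>c (B *\<^sub>v (B ^\<^sub>m m *\<^sub>v y))"
      using herm Suc.prems(1) mult_mat_vec_carrier[OF P Suc.prems(2), of m]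
      by (simp add: hermitian_def)
    also have "B *\<^sub>v (B ^\<^sub>m m *\<^sub>v y) = B ^\<^sub>m Suc m *\<^sub>v y"
      using pow_mat_add[OF B, of 1 m] B assoc_mult_mat_vec[OF B P Suc.prems(2), of m] by simp
    finally show ?case .
  qed (use B in simp)
  let ?m = "2 ^ k :: nat"
  let ?x = "B ^\<^sub>m ?m *\<^sub>v v"
  have x: "?x \<in> carrier_vec d" by (rule mult_mat_vec_carrier[OF P v(1)])
  have "Re (?x \<bullet>c v) \<le> vnorm ?x"
    using cscalar_prod_Cauchy_Schwarz[OF x v(1)] complex_Re_le_cmod[of "?x \<bullet>c v"] v(2) by simp
  then have "(b ^ ?m)\<^sup>2 \<le> (vnorm ?x)\<^sup>2"
    using Suc b by (intro power_mono) auto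
  also have "(vnorm ?x)\<^sup>2 = Re (?x \<bullet>c ?x)"
    by (simp add: cscalar_prod_self)
  also have "?x \<bullet>c ?x = (B ^\<^sub>m ?m *\<^sub>v ?x) \<bullet>c v"
    using pow_herm[OF x v(1), of ?m] by simp
  also have "B ^\<^sub>m ?m *\<^sub>v ?x = B ^\<^sub>m (2 ^ Suc k) *\<^sub>v v"
    using assoc_mult_mat_vec[OF P P v(1), of ?m ?m] pow_mat_add[OF B, of ?m ?m]
    by (simp add: mult_2)
  finally show ?case by (simp add: power_mult[symmetric] mult.commute)
qed

text \<open>The right side depends on \<open>P\<close> only through \<open>c\<close>, so one
  entrywise bound valid for all powers of a matrix bounds all their quadratic forms at a fixed
  \<open>v\<close>.\<close>

lemma norm_bound_cscalar_prod:
  assumes "P \<in> carrier_mat d d" "norm_bound P c" "v \<in> carrier_vec d"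
  shows "cmod ((P *\<^sub>v v) \<bullet>c v) \<le> (\<Sum>i = 0..<d. \<Sum>j = 0..<d. c * cmod (v $ j) * cmod (v $ i))"
proof -
  have "(P *\<^sub>v v) \<bullet>c v = (\<Sum>i = 0..<d. \<Sum>j = 0..<d. P $$ (i, j) * v $ j * cnj (v $ i))"
    using assms unfolding scalar_prod_def by (auto simp: sum_distrib_right scalar_prod_def)
  also have "cmod \<dots> \<le> (\<Sum>i = 0..<d. \<Sum>j = 0..<d. cmod (P $$ (i, j) * v $ j * cnj (v $ i)))"
    by (intro order.trans[OF norm_sum] sum_mono) simp
  also have "\<dots> \<le> (\<Sum>i = 0..<d. \<Sum>j = 0..<d. c * cmod (v $ j) * cmod (v $ i))"
    using assms by (intro sum_mono) (auto simp: norm_mult norm_bound_def intro!: mult_right_mono)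
  finally show ?thesis .
qed

text \<open>If all eigenvalues exceeded \<open>\<mu>\<close>, then for suitable \<open>s, t > 0\<close> the matrix
  \<open>B = t (s - A)\<close> would have spectral radius below \<open>1\<close>, hence bounded powers, although its
  quadratic form exceeds \<open>1\<close> at the normalised \<open>v\<close>.\<close>

lemma hermitian_Rayleigh:
  assumes herm: "hermitian d A" and v: "v \<in> carrier_vec d" "v \<noteq> 0\<^sub>v d"
    and le: "Re ((A *\<^sub>v v) \<bullet>c v) \<le> \<mu> * (vnorm v)\<^sup>2"
  shows "\<exists>l u. eigenvector A u (complex_of_real l) \<and> l \<le> \<mu>"
proof (rule ccontr)
  assume "\<not> ?thesis"
  then have gt: "\<And>l u. eigenvector A u (complex_of_real l) \<Longrightarrow> \<mu> < l"
    by (meson not_le)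
  have A: "A \<in> carrier_mat d d" using herm by (simp add: hermitian_def)
  have "0 < d" using v by (cases d) auto
  define E where "E = Re ` spectrum A"
  have finE: "finite E" "E \<noteq> {}"
    using card_finite_spectrum[OF A] spectrum_non_empty[OF A \<open>0 < d\<close>] unfolding E_def by auto
  have E_gt: "\<mu> < l" if "l \<in> E" for l
    using that gt hermitian_eigenvalue_real[OF herm]
    unfolding E_def spectrum_def eigenvalue_def by (auto; metis)
  \<comment> \<open>\<open>r\<close> is the midpoint of \<open>\<mu>\<close> and the least
    eigenvalue. The gap on its right makes \<open>s - r\<close> positive even if \<open>A\<close>
    has a single eigenvalue, and puts the spectrum of \<open>B\<close> into \<open>[0, 1)\<close>;
    the gap on its left gives \<open>t * (s - \<mu>) > 1\<close>.\<close>
  define r where "r = (\<mu> + Min E) / 2"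
  define s where "s = Max E"
  define t where "t = 1 / (s - r)"
  have r: "\<mu> < r" "r < Min E" using E_gt finE unfolding r_def by auto
  have "Min E \<le> s" unfolding s_def using finE by simp
  then have "r < s" using r by simp
  then have t: "0 < t" unfolding t_def by simp
  define B where "B = complex_of_real t \<cdot>\<^sub>m (complex_of_real s \<cdot>\<^sub>m 1\<^sub>m d - A)"
  have B: "B \<in> carrier_mat d d" using A unfolding B_def by auto
  have Bu: "B *\<^sub>v u = complex_of_real t \<cdot>\<^sub>v (complex_of_real s \<cdot>\<^sub>v u - A *\<^sub>v u)"
    if "u \<in> carrier_vec d" for u
  proof -
    have sI: "complex_of_real s \<cdot>\<^sub>m 1\<^sub>m d \<in> carrier_mat d d" by simp
    have "B *\<^sub>v u = complex_of_real t \<cdot>\<^sub>v ((complex_of_real s \<cdot>\<^sub>m 1\<^sub>m d - A) *\<^sub>v u)"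
      unfolding B_def using that A by (intro smult_mat_mult_vec[of _ d d]) auto
    also have "(complex_of_real s \<cdot>\<^sub>m 1\<^sub>m d - A) *\<^sub>v u = complex_of_real s \<cdot>\<^sub>v u - A *\<^sub>v u"
      using that smult_mat_mult_vec[of "1\<^sub>m d" d d u]
      by (subst minus_mult_distrib_mat_vec[OF sI A that]) simp
    finally show ?thesis .
  qed
  have herm_B: "hermitian d B"
    unfolding hermitian_def
  proof (intro conjI ballI)
    fix u w :: "complex vec" assume u: "u \<in> carrier_vec d" and w: "w \<in> carrier_vec d"
    have Auw: "A *\<^sub>v u \<in> carrier_vec d" "A *\<^sub>v w \<in> carrier_vec d" using A u w by auto
    show "(B *\<^sub>v u) \<bullet>c w = u \<bullet>c (B *\<^sub>v w)"
      using herm u w Auw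
      by (simp add: Bu cscalar_prod_smult_left[of _ d] cscalar_prod_smult_right[of _ d]
          cscalar_prod_minus_left[of _ d] cscalar_prod_minus_right[of _ d] hermitian_def
          del: smult_scalar_prod_distrib scalar_prod_smult_distrib)
  qed (rule B)
  have "cmod e < 1" if "e \<in> spectrum B" for e
  proof -
    obtain u where u: "u \<in> carrier_vec d" "u \<noteq> 0\<^sub>v d" "B *\<^sub>v u = e \<cdot>\<^sub>v u"
      using \<open>e \<in> spectrum B\<close> B unfolding spectrum_def eigenvalue_def eigenvector_def by auto
    have "A *\<^sub>v u = (complex_of_real s - e / complex_of_real t) \<cdot>\<^sub>v u"
    proof (rule eq_vecI)
      fix i assume "i < dim_vec ((complex_of_real s - e / complex_of_real t) \<cdot>\<^sub>v u)"
      then have i: "i < d" using u by simp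
      have "(B *\<^sub>v u) $ i = (e \<cdot>\<^sub>v u) $ i" using u by simp
      then have "complex_of_real t * (complex_of_real s * u $ i - (A *\<^sub>v u) $ i) = e * u $ i"
        using i u(1) A Bu[OF u(1)] by simp
      then show "(A *\<^sub>v u) $ i = ((complex_of_real s - e / complex_of_real t) \<cdot>\<^sub>v u) $ i"
        using i u(1) t by (simp add: field_simps)
    qed (use A u in auto)
    then have ev: "eigenvector A u (complex_of_real s - e / complex_of_real t)"
      using u A unfolding eigenvector_def by auto
    define l where "l = Re (complex_of_real s - e / complex_of_real t)"
    have l: "complex_of_real s - e / complex_of_real t = complex_of_real l"
      unfolding l_def by (rule hermitian_eigenvalue_real[OF herm ev])
    then have "e = complex_of_real (t * (s - l))" using t by (simp add: field_simps)
    moreover have "l \<in> E"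
      using ev l unfolding E_def spectrum_def eigenvalue_def by force
    then have "Min E \<le> l" "l \<le> s" using finE unfolding s_def by auto
    then have "0 \<le> s - l" "s - l < s - r" using r by auto
    then have "0 \<le> t * (s - l)" "t * (s - l) < 1"
      using \<open>r < s\<close> unfolding t_def by (auto simp: field_simps)
    ultimately show ?thesis by (simp only: norm_of_real)
  qed
  then have "spectral_radius B < 1"
    using spectral_radius_mem_max(1)[OF B \<open>0 < d\<close>] by auto
  then obtain c where c: "\<And>k. norm_bound (B ^\<^sub>m k) c"
    using spectral_radius_jnf_norm_bound_less_1_upper_triangular[OF B] by auto
  define x where "x = complex_of_real (1 / vnorm v) \<cdot>\<^sub>v v"
  have nv: "0 < vnorm v" using v vnorm_pos_iff by simp
  have x: "x \<in> carrier_vec d" using v unfolding x_def by simp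
  have scale: "(complex_of_real (1 / vnorm v) \<cdot>\<^sub>v w) \<bullet>c x
      = complex_of_real (1 / (vnorm v)\<^sup>2) * (w \<bullet>c v)" if "w \<in> carrier_vec d" for w
    using that v unfolding x_def
    by (simp add: cscalar_prod_smult_left[of _ d] cscalar_prod_smult_right[of _ d] power2_eq_square
          del: smult_scalar_prod_distrib scalar_prod_smult_distrib)
  have "x \<bullet>c x = complex_of_real (1 / (vnorm v)\<^sup>2) * (v \<bullet>c v)"
    using scale[OF v(1)] by (simp only: x_def[symmetric])
  also have "\<dots> = complex_of_real (1 / (vnorm v)\<^sup>2 * (vnorm v)\<^sup>2)"
    by (simp only: cscalar_prod_self of_real_mult)
  also have "1 / (vnorm v)\<^sup>2 * (vnorm v)\<^sup>2 = 1" using nv by simp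
  finally have xx: "x \<bullet>c x = 1" by simp
  then have nx: "vnorm x = 1"
    using vnorm_nonneg[of x] by (simp add: cscalar_prod_self power2_eq_1_iff flip: of_real_power)
  define b where "b = t * (s - \<mu>)"
  have "1 < b" using r \<open>r < s\<close> unfolding b_def t_def by (simp add: field_simps)
  have Ax: "A *\<^sub>v x = complex_of_real (1 / vnorm v) \<cdot>\<^sub>v (A *\<^sub>v v)"
    unfolding x_def using A v by (simp add: mult_mat_vec)
  have "A *\<^sub>v v \<in> carrier_vec d" using A v by simp
  then have "(A *\<^sub>v x) \<bullet>c x = complex_of_real (1 / (vnorm v)\<^sup>2) * ((A *\<^sub>v v) \<bullet>c v)"
    unfolding Ax by (rule scale)
  then have "Re ((A *\<^sub>v x) \<bullet>c x) = Re ((A *\<^sub>v v) \<bullet>c v) / (vnorm v)\<^sup>2"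
    by (simp del: of_real_divide of_real_power)
  then have "Re ((A *\<^sub>v x) \<bullet>c x) \<le> \<mu>"
    using le nv by (simp add: divide_le_eq)
  moreover have "(B *\<^sub>v x) \<bullet>c x = complex_of_real t * (complex_of_real s - (A *\<^sub>v x) \<bullet>c x)"
    using x A xx
    by (simp add: Bu cscalar_prod_smult_left[of _ d] cscalar_prod_minus_left[of _ d]
          del: smult_scalar_prod_distrib)
  ultimately have "b \<le> Re ((B *\<^sub>v x) \<bullet>c x)"
    using t unfolding b_def by simp
  from hermitian_power_growth[OF herm_B x nx _ this]
  have growth: "b ^ (2 ^ k) \<le> Re ((B ^\<^sub>m (2 ^ k) *\<^sub>v x) \<bullet>c x)" for k
    using \<open>1 < b\<close> by simp
  define C where "C = (\<Sum>i = 0..<d. \<Sum>j = 0..<d. c * cmod (x $ j) * cmod (x $ i))"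
  have bound: "b ^ (2 ^ k) \<le> C" for k
    using growth[of k] complex_Re_le_cmod[of "(B ^\<^sub>m (2 ^ k) *\<^sub>v x) \<bullet>c x"]
      norm_bound_cscalar_prod[OF pow_carrier_mat[OF B] c x, of "2 ^ k"]
    unfolding C_def by linarith
  \<comment> \<open>The lower bound is available along the exponents \<open>2 ^ k\<close> only;
    archimedean growth of \<open>b ^ k\<close> is brought in through
    \<open>k \<le> 2 ^ k\<close>.\<close>
  obtain k where "C < b ^ k" using real_arch_pow[OF \<open>1 < b\<close>] by blast
  also have "b ^ k \<le> b ^ (2 ^ k)"
    using \<open>1 < b\<close> less_exp[of k] by (intro power_increasing) auto
  also have "\<dots> \<le> C" by (rule bound)
  finally show False by simp
qed

section \<open>Unitary representations and intertwiners\<close>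

text \<open>The dimensions are explicit arguments, so the result has the right shape for every index
  set and its entries are ordinary finite sums.\<close>

definition msum :: "nat \<Rightarrow> nat \<Rightarrow> ('i \<Rightarrow> complex mat) \<Rightarrow> 'i set \<Rightarrow> complex mat" where
  "msum d e F I = mat d e (\<lambda>(i, j). \<Sum>x\<in>I. F x $$ (i, j))"

lemma msum_carrier: "msum d e F I \<in> carrier_mat d e"
  unfolding msum_def by simp

lemma msum_cscalar_prod:
  assumes F: "\<And>x. x \<in> I \<Longrightarrow> F x \<in> carrier_mat d e"
    and u: "u \<in> carrier_vec e" and y: "y \<in> carrier_vec d"
  shows "(msum d e F I *\<^sub>v u) \<bullet>c y = (\<Sum>x\<in>I. (F x *\<^sub>v u) \<bullet>c y)"
proof -
  have expand: "(A *\<^sub>v u) \<bullet>c y = (\<Sum>i = 0..<d. \<Sum>j = 0..<e. A $$ (i, j) * u $ j * cnj (y $ i))"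
    if "A \<in> carrier_mat d e" for A
    using that u y unfolding scalar_prod_def by (auto simp: sum_distrib_right scalar_prod_def)
  have "(msum d e F I *\<^sub>v u) \<bullet>c y
      = (\<Sum>i = 0..<d. \<Sum>j = 0..<e. \<Sum>x\<in>I. F x $$ (i, j) * u $ j * cnj (y $ i))"
    unfolding expand[OF msum_carrier] by (simp add: msum_def sum_distrib_right)
  also have "\<dots> = (\<Sum>i = 0..<d. \<Sum>x\<in>I. \<Sum>j = 0..<e. F x $$ (i, j) * u $ j * cnj (y $ i))"
    by (intro sum.cong refl sum.swap)
  also have "\<dots> = (\<Sum>x\<in>I. \<Sum>i = 0..<d. \<Sum>j = 0..<e. F x $$ (i, j) * u $ j * cnj (y $ i))"
    by (rule sum.swap)
  also have "\<dots> = (\<Sum>x\<in>I. (F x *\<^sub>v u) \<bullet>c y)"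
    by (intro sum.cong refl) (simp add: expand[OF F])
  finally show ?thesis .
qed

lemma subspaceI:
  assumes "W \<subseteq> carrier_vec d" "0\<^sub>v d \<in> W"
    and "\<And>u v. u \<in> W \<Longrightarrow> v \<in> W \<Longrightarrow> u + v \<in> W"
    and "\<And>a u. u \<in> W \<Longrightarrow> a \<cdot>\<^sub>v u \<in> W"
  shows "VectorSpace.subspace class_ring W (module_vec TYPE(complex) d)"
  unfolding VectorSpace.subspace_def submodule_def
  using assms vec_vs[of d] vec_module[of d] by (auto simp: module_vec_simps)

lemma subspaceD:
  assumes "VectorSpace.subspace class_ring W (module_vec TYPE(complex) d)"
  shows "W \<subseteq> carrier_vec d" "0\<^sub>v d \<in> W"
    and "\<And>u v. u \<in> W \<Longrightarrow> v \<in> W \<Longrightarrow> u + v \<in> W"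
    and "\<And>a u. u \<in> W \<Longrightarrow> a \<cdot>\<^sub>v u \<in> W"
  using assms unfolding VectorSpace.subspace_def submodule_def
  by (auto simp: module_vec_simps)

text \<open>Both sides of \<open>tr (A B) = tr (B A)\<close> are evaluated. The equality of
  dimensions is wanted because \<open>invertible_mat\<close> includes squareness.\<close>

lemma square_of_two_sided_inverse:
  assumes A: "A \<in> carrier_mat m n" and B: "B \<in> carrier_mat n m"
    and "A * B = (1\<^sub>m m :: complex mat)" "B * A = 1\<^sub>m n"
  shows "m = n"
proof -
  have tr: "(\<Sum>i = 0..<k. (X * Y) $$ (i, i)) = (\<Sum>i = 0..<k. \<Sum>j = 0..<l. X $$ (i, j) * Y $$ (j, i))"
    if "X \<in> carrier_mat k l" "Y \<in> carrier_mat l k" for X Y :: "complex mat" and k l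
    using that by (auto simp: scalar_prod_def intro!: sum.cong)
  have "complex_of_nat m = (\<Sum>i = 0..<m. (A * B) $$ (i, i))"
    using assms by simp
  also have "\<dots> = (\<Sum>i = 0..<m. \<Sum>j = 0..<n. B $$ (j, i) * A $$ (i, j))"
    by (simp add: tr[OF A B] mult.commute)
  also have "\<dots> = (\<Sum>j = 0..<n. (B * A) $$ (j, j))"
    by (subst sum.swap) (simp add: tr[OF B A])
  also have "\<dots> = complex_of_nat n"
    using assms by simp
  finally show ?thesis by simp
qed

text \<open>The relation inside \<open>rep_iso\<close> with invertibility dropped, that is, an
  element of the space of \<open>H\<close>-equivariant maps.\<close>

definition intertwiner ::
  "'h monoid \<Rightarrow> nat \<Rightarrow> ('h \<Rightarrow> complex mat) \<Rightarrow> nat \<Rightarrow> ('h \<Rightarrow> complex mat) \<Rightarrow> complex mat \<Rightarrow> bool" where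
  "intertwiner H d \<rho> d' \<rho>' T \<longleftrightarrow> T \<in> carrier_mat d' d \<and> (\<forall>h\<in>carrier H. T * \<rho> h = \<rho>' h * T)"

lemma rep_iso_iff_intertwiner:
  "rep_iso H d \<rho> d' \<rho>' \<longleftrightarrow> (\<exists>T. intertwiner H d \<rho> d' \<rho>' T \<and> invertible_mat T)"
  unfolding rep_iso_def intertwiner_def by blast

definition real_eigenvalues :: "complex mat \<Rightarrow> real set" where
  "real_eigenvalues A = {l. \<exists>v. eigenvector A v (complex_of_real l)}"

lemma finite_real_eigenvalues:
  assumes "A \<in> carrier_mat d d"
  shows "finite (real_eigenvalues A)"
proof (rule finite_subset)
  show "real_eigenvalues A \<subseteq> Re ` spectrum A"
    unfolding real_eigenvalues_def spectrum_def eigenvalue_def by force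
qed (use card_finite_spectrum[OF assms] in simp)

lemma hermitian_real_eigenvalues_nonempty:
  assumes "hermitian d A" "0 < d"
  shows "real_eigenvalues A \<noteq> {}"
proof -
  have "A \<in> carrier_mat d d" using assms by (simp add: hermitian_def)
  then obtain e v where ev: "eigenvector A v e"
    using spectrum_non_empty assms(2) unfolding spectrum_def eigenvalue_def by blast
  then have "eigenvector A v (complex_of_real (Re e))"
    using hermitian_eigenvalue_real[OF assms(1) ev] by simp
  then show ?thesis unfolding real_eigenvalues_def by blast
qed

section \<open>Finite groups: unitary matrices and the operators of the group algebra\<close>

locale finite_group = group H for H :: "'h monoid" (structure) +
  assumes finite_carrier: "finite (carrier H)"
begin

lemma
  assumes "unitary_rep H d \<rho>" and "h \<in> carrier H"
  shows rep_carrier: "\<rho> h \<in> carrier_mat d d"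
    and rep_unitary: "\<rho> h * mat_adjoint (\<rho> h) = 1\<^sub>m d" "mat_adjoint (\<rho> h) * \<rho> h = 1\<^sub>m d"
  using assms unfolding unitary_rep_def hom_def unitary_group_def by auto

lemma rep_mult:
  assumes "unitary_rep H d \<rho>" "h \<in> carrier H" "k \<in> carrier H"
  shows "\<rho> (h \<otimes> k) = \<rho> h * \<rho> k"
  using assms unfolding unitary_rep_def hom_def unitary_group_def by auto

lemma rep_act:
  assumes "unitary_rep H d \<rho>" "h \<in> carrier H" "k \<in> carrier H" "u \<in> carrier_vec d"
  shows "\<rho> (h \<otimes> k) *\<^sub>v u = \<rho> h *\<^sub>v (\<rho> k *\<^sub>v u)"
  using assms rep_carrier by (simp add: rep_mult[of d] assoc_mult_mat_vec[of _ d d _ d])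

lemma rep_vec_carrier:
  assumes "unitary_rep H d \<rho>" "h \<in> carrier H" "u \<in> carrier_vec d"
  shows "\<rho> h *\<^sub>v u \<in> carrier_vec d"
  using rep_carrier[OF assms(1,2)] assms(3) by simp

lemma rep_one:
  assumes "unitary_rep H d \<rho>"
  shows "\<rho> \<one> = 1\<^sub>m d"
proof -
  note C = rep_carrier[OF assms one_closed]
  note U = rep_unitary[OF assms one_closed]
  have "\<rho> \<one> * \<rho> \<one> = \<rho> \<one>"
    using rep_mult[OF assms one_closed one_closed] by simp
  then have "mat_adjoint (\<rho> \<one>) * (\<rho> \<one> * \<rho> \<one>) = 1\<^sub>m d"
    using U by simp
  then show ?thesis
    using U(2) C by (simp add: assoc_mult_mat[OF mat_adjoint_carrier[OF C] C C, symmetric])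
qed

lemma rep_one_act:
  assumes "unitary_rep H d \<rho>" "u \<in> carrier_vec d"
  shows "\<rho> \<one> *\<^sub>v u = u"
  using assms by (simp add: rep_one[of d])

lemma rep_inv:
  assumes "unitary_rep H d \<rho>" and h: "h \<in> carrier H"
  shows "\<rho> (inv h) = mat_adjoint (\<rho> h)"
proof -
  note C = rep_carrier[OF assms] and C' = rep_carrier[OF assms(1) inv_closed[OF h]]
  have "\<rho> h * \<rho> (inv h) = 1\<^sub>m d"
    using rep_mult[OF assms inv_closed[OF h]] rep_one[OF assms(1)] h by simp
  then have "mat_adjoint (\<rho> h) = mat_adjoint (\<rho> h) * (\<rho> h * \<rho> (inv h))"
    using mat_adjoint_carrier[OF C] by simp
  also have "\<dots> = \<rho> (inv h)"
    using rep_unitary(2)[OF assms] C C'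
    by (simp add: assoc_mult_mat[OF mat_adjoint_carrier[OF C] C C', symmetric])
  finally show ?thesis by simp
qed

lemma rep_cscalar_prod:
  assumes "unitary_rep H d \<rho>" "h \<in> carrier H" "u \<in> carrier_vec d" "y \<in> carrier_vec d"
  shows "(\<rho> h *\<^sub>v u) \<bullet>c y = u \<bullet>c (\<rho> (inv h) *\<^sub>v y)"
  using mat_adjoint_cscalar_prod[OF rep_carrier[OF assms(1,2)] assms(3,4)] rep_inv[OF assms(1,2)]
  by simp

lemma rep_inv_act:
  assumes "unitary_rep H d \<rho>" "h \<in> carrier H" "u \<in> carrier_vec d"
  shows "\<rho> (inv h) *\<^sub>v (\<rho> h *\<^sub>v u) = u"
  using rep_act[OF assms(1) inv_closed[OF assms(2)] assms(2,3)] assms rep_one_act by simp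

lemma rep_vnorm:
  assumes "unitary_rep H d \<rho>" "h \<in> carrier H" "u \<in> carrier_vec d"
  shows "vnorm (\<rho> h *\<^sub>v u) = vnorm u"
proof -
  have "(\<rho> h *\<^sub>v u) \<bullet>c (\<rho> h *\<^sub>v u) = u \<bullet>c u"
    using rep_cscalar_prod[OF assms rep_vec_carrier[OF assms]] rep_inv_act[OF assms] by simp
  then have "(vnorm (\<rho> h *\<^sub>v u))\<^sup>2 = (vnorm u)\<^sup>2"
    by (simp add: cscalar_prod_self flip: of_real_power)
  then show ?thesis
    using vnorm_nonneg by (simp add: power2_eq_iff_nonneg)
qed

lemma ga_rep_carrier: "ga_rep H d \<rho> w \<in> carrier_mat d d"
  unfolding ga_rep_def by simp

lemma ga_rep_cscalar_prod:
  assumes "unitary_rep H d \<rho>" "u \<in> carrier_vec d" "y \<in> carrier_vec d"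
  shows "(ga_rep H d \<rho> w *\<^sub>v u) \<bullet>c y
    = (\<Sum>h\<in>carrier H. complex_of_real (w h) * ((\<rho> h *\<^sub>v u) \<bullet>c y))"
proof -
  have "ga_rep H d \<rho> w = msum d d (\<lambda>h. complex_of_real (w h) \<cdot>\<^sub>m \<rho> h) (carrier H)"
    unfolding ga_rep_def msum_def using rep_carrier[OF assms(1)]
    by (intro cong_mat refl) (auto intro!: sum.cong, metis carrier_matD index_smult_mat(1))
  also have "(\<dots> *\<^sub>v u) \<bullet>c y
      = (\<Sum>h\<in>carrier H. ((complex_of_real (w h) \<cdot>\<^sub>m \<rho> h) *\<^sub>v u) \<bullet>c y)"
    using assms rep_carrier[OF assms(1)] by (intro msum_cscalar_prod) auto
  also have "\<dots> = (\<Sum>h\<in>carrier H. complex_of_real (w h) * ((\<rho> h *\<^sub>v u) \<bullet>c y))"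
    using assms(2,3) rep_vec_carrier[OF assms(1)]
    by (intro sum.cong refl)
      (simp add: smult_mat_mult_vec[OF rep_carrier[OF assms(1)]] cscalar_prod_smult_left[of _ d]
        del: smult_scalar_prod_distrib)
  finally show ?thesis .
qed

text \<open>The two basis functions in \<open>ga_Delta\<close> collapse once the order of summation
  is exchanged. Estimates on \<open>\<Delta>\<close> start from this form, in which no matrix
  entries are left.\<close>

lemma ga_Delta_cscalar_prod:
  assumes "unitary_rep H d \<rho>" "u \<in> carrier_vec d" "y \<in> carrier_vec d"
  shows "(ga_rep H d \<rho> (ga_Delta H w) *\<^sub>v u) \<bullet>c y
    = (\<Sum>h\<in>carrier H. complex_of_real (w h) * (u \<bullet>c y - (\<rho> h *\<^sub>v u) \<bullet>c y))"
proof -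
  define f where "f x = (\<rho> x *\<^sub>v u) \<bullet>c y" for x
  have basis: "(\<Sum>x\<in>carrier H. complex_of_real (ga_basis h x) * f x) = f h" if "h \<in> carrier H" for h
    using that finite_carrier unfolding ga_basis_def
    by (simp add: if_distrib[of complex_of_real] if_distrib[of "\<lambda>z. z * _"] cong: if_cong)
  have "(ga_rep H d \<rho> (ga_Delta H w) *\<^sub>v u) \<bullet>c y
      = (\<Sum>x\<in>carrier H. \<Sum>h\<in>carrier H. complex_of_real (w h)
          * (complex_of_real (ga_basis \<one> x) * f x - complex_of_real (ga_basis h x) * f x))"
    unfolding ga_rep_cscalar_prod[OF assms] ga_Delta_def f_def
    by (intro sum.cong refl) (simp add: of_real_sum sum_distrib_left right_diff_distrib left_diff_distrib mult_ac)
  also have "\<dots> = (\<Sum>h\<in>carrier H. complex_of_real (w h) * (f \<one> - f h))"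
    by (subst sum.swap) (simp add: sum_distrib_left[symmetric] sum_subtractf basis)
  finally show ?thesis
    using rep_one_act[OF assms(1,2)] unfolding f_def by simp
qed

text \<open>The adjoint of \<open>\<rho> h\<close> is \<open>\<rho> (inv h)\<close>, so passing to
  the adjoint reindexes the sum by inversion, which \<open>w\<close> does not see.\<close>

lemma hermitian_ga_Delta:
  assumes rep: "unitary_rep H d \<rho>" and sym: "\<And>h. h \<in> carrier H \<Longrightarrow> w (inv h) = w h"
  shows "hermitian d (ga_rep H d \<rho> (ga_Delta H w))"
  unfolding hermitian_def
proof (intro conjI ballI)
  let ?A = "ga_rep H d \<rho> (ga_Delta H w)"
  fix u y :: "complex vec" assume u: "u \<in> carrier_vec d" and y: "y \<in> carrier_vec d"
  have Ay: "?A *\<^sub>v y \<in> carrier_vec d"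
    using ga_rep_carrier y by (rule mult_mat_vec_carrier)
  have "u \<bullet>c (?A *\<^sub>v y) = cnj ((?A *\<^sub>v y) \<bullet>c u)"
    using cscalar_prod_cnj[OF Ay u] by simp
  also have "\<dots> = (\<Sum>h\<in>carrier H. complex_of_real (w h) * (u \<bullet>c y - (\<rho> (inv h) *\<^sub>v u) \<bullet>c y))"
  proof -
    have "cnj ((\<rho> h *\<^sub>v y) \<bullet>c u) = (\<rho> (inv h) *\<^sub>v u) \<bullet>c y" if "h \<in> carrier H" for h
      using that rep_cscalar_prod[OF rep inv_closed[OF that] u y]
        cscalar_prod_cnj[OF rep_vec_carrier[OF rep that y] u] by simp
    then show ?thesis
      using cscalar_prod_cnj[OF y u] by (simp add: ga_Delta_cscalar_prod[OF rep y u])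
  qed
  also have "\<dots> = (\<Sum>h\<in>carrier H. complex_of_real (w h) * (u \<bullet>c y - (\<rho> h *\<^sub>v u) \<bullet>c y))"
    by (rule sum.reindex_bij_witness[of _ "\<lambda>h. inv h" "\<lambda>h. inv h"]) (auto simp: sym)
  also have "\<dots> = (?A *\<^sub>v u) \<bullet>c y"
    by (rule ga_Delta_cscalar_prod[OF rep u y, symmetric])
  finally show "(?A *\<^sub>v u) \<bullet>c y = u \<bullet>c (?A *\<^sub>v y)" by simp
qed (rule ga_rep_carrier)

section \<open>Intertwiners, averaging over the group and Schur's lemma\<close>

lemma intertwiner_act:
  assumes "unitary_rep H d \<rho>" "unitary_rep H d' \<rho>'" "intertwiner H d \<rho> d' \<rho>' T"
    and "h \<in> carrier H" "u \<in> carrier_vec d"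
  shows "T *\<^sub>v (\<rho> h *\<^sub>v u) = \<rho>' h *\<^sub>v (T *\<^sub>v u)"
proof -
  have T: "T \<in> carrier_mat d' d" "T * \<rho> h = \<rho>' h * T"
    using assms unfolding intertwiner_def by auto
  then show ?thesis
    using assoc_mult_mat_vec[OF T(1) rep_carrier[OF assms(1,4)] assms(5)]
      assoc_mult_mat_vec[OF rep_carrier[OF assms(2,4)] T(1) assms(5)] by simp
qed

text \<open>\<open>T\<close> is moved onto the test vector as its adjoint, so that the sum over the
  group can be opened; it returns term by term.\<close>

lemma intertwiner_ga_rep:
  assumes rep: "unitary_rep H d \<rho>" "unitary_rep H d' \<rho>'" and T: "intertwiner H d \<rho> d' \<rho>' T"
    and u: "u \<in> carrier_vec d"
  shows "T *\<^sub>v (ga_rep H d \<rho> w *\<^sub>v u) = ga_rep H d' \<rho>' w *\<^sub>v (T *\<^sub>v u)"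
proof (rule vec_eq_cscalar_prodI)
  have TC: "T \<in> carrier_mat d' d" using T unfolding intertwiner_def by simp
  have gu: "ga_rep H d \<rho> w *\<^sub>v u \<in> carrier_vec d"
    using ga_rep_carrier u by (rule mult_mat_vec_carrier)
  have Tu: "T *\<^sub>v u \<in> carrier_vec d'" using TC u by (rule mult_mat_vec_carrier)
  show "T *\<^sub>v (ga_rep H d \<rho> w *\<^sub>v u) \<in> carrier_vec d'"
    using TC gu by (rule mult_mat_vec_carrier)
  show "ga_rep H d' \<rho>' w *\<^sub>v (T *\<^sub>v u) \<in> carrier_vec d'"
    using ga_rep_carrier Tu by (rule mult_mat_vec_carrier)
  fix y :: "complex vec" assume y: "y \<in> carrier_vec d'"
  have Ty: "mat_adjoint T *\<^sub>v y \<in> carrier_vec d"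
    using mat_adjoint_carrier[OF TC] y by (rule mult_mat_vec_carrier)
  have "(T *\<^sub>v (ga_rep H d \<rho> w *\<^sub>v u)) \<bullet>c y = (ga_rep H d \<rho> w *\<^sub>v u) \<bullet>c (mat_adjoint T *\<^sub>v y)"
    by (rule mat_adjoint_cscalar_prod[OF TC gu y])
  also have "\<dots> = (\<Sum>h\<in>carrier H. complex_of_real (w h) * ((\<rho> h *\<^sub>v u) \<bullet>c (mat_adjoint T *\<^sub>v y)))"
    by (rule ga_rep_cscalar_prod[OF rep(1) u Ty])
  also have "\<dots> = (\<Sum>h\<in>carrier H. complex_of_real (w h) * ((\<rho>' h *\<^sub>v (T *\<^sub>v u)) \<bullet>c y))"
    using mat_adjoint_cscalar_prod[OF TC rep_vec_carrier[OF rep(1) _ u] y]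
      intertwiner_act[OF rep T _ u] by (intro sum.cong refl) simp
  also have "\<dots> = (ga_rep H d' \<rho>' w *\<^sub>v (T *\<^sub>v u)) \<bullet>c y"
    by (rule ga_rep_cscalar_prod[OF rep(2) Tu y, symmetric])
  finally show "(T *\<^sub>v (ga_rep H d \<rho> w *\<^sub>v u)) \<bullet>c y = (ga_rep H d' \<rho>' w *\<^sub>v (T *\<^sub>v u)) \<bullet>c y" .
qed

lemma intertwiner_eigenvector:
  assumes rep: "unitary_rep H d \<rho>" "unitary_rep H d' \<rho>'" and T: "intertwiner H d \<rho> d' \<rho>' T"
    and ev: "eigenvector (ga_rep H d \<rho> w) u l" and "T *\<^sub>v u \<noteq> 0\<^sub>v d'"
  shows "eigenvector (ga_rep H d' \<rho>' w) (T *\<^sub>v u) l"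
proof -
  have TC: "T \<in> carrier_mat d' d" using T unfolding intertwiner_def by simp
  have u: "u \<in> carrier_vec d" "ga_rep H d \<rho> w *\<^sub>v u = l \<cdot>\<^sub>v u"
    using ev ga_rep_carrier[of d \<rho> w] unfolding eigenvector_def by auto
  have "ga_rep H d' \<rho>' w *\<^sub>v (T *\<^sub>v u) = l \<cdot>\<^sub>v (T *\<^sub>v u)"
    using intertwiner_ga_rep[OF rep T u(1), of w] u TC by (simp add: mult_mat_vec)
  then show ?thesis
    using assms(5) TC u ga_rep_carrier[of d' \<rho>' w] unfolding eigenvector_def by auto
qed

text \<open>This is \<open>|H|\<close> times the projection of matrices onto intertwiners. The
  factor is harmless, since the only use is that an inner product formed with it vanishes.\<close>

definition averaged ::
  "nat \<Rightarrow> ('h \<Rightarrow> complex mat) \<Rightarrow> nat \<Rightarrow> ('h \<Rightarrow> complex mat) \<Rightarrow> complex mat \<Rightarrow> complex mat" where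
  "averaged d \<rho> d' \<rho>' A = msum d' d (\<lambda>h. \<rho>' (inv h) * A * \<rho> h) (carrier H)"

lemma averaged_cscalar_prod:
  assumes rep: "unitary_rep H d \<rho>" "unitary_rep H d' \<rho>'" and A: "A \<in> carrier_mat d' d"
    and u: "u \<in> carrier_vec d" and y: "y \<in> carrier_vec d'"
  shows "(averaged d \<rho> d' \<rho>' A *\<^sub>v u) \<bullet>c y
    = (\<Sum>h\<in>carrier H. (A *\<^sub>v (\<rho> h *\<^sub>v u)) \<bullet>c (\<rho>' h *\<^sub>v y))"
proof -
  have "(averaged d \<rho> d' \<rho>' A *\<^sub>v u) \<bullet>c y
      = (\<Sum>h\<in>carrier H. ((\<rho>' (inv h) * A * \<rho> h) *\<^sub>v u) \<bullet>c y)"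
    unfolding averaged_def
    by (intro msum_cscalar_prod u y mult_carrier_mat[OF mult_carrier_mat[OF rep_carrier[OF rep(2)] A]]
        rep_carrier[OF rep(1)] inv_closed)
  also have "\<dots> = (\<Sum>h\<in>carrier H. (A *\<^sub>v (\<rho> h *\<^sub>v u)) \<bullet>c (\<rho>' h *\<^sub>v y))"
  proof (intro sum.cong refl)
    fix h assume h: "h \<in> carrier H"
    note C = rep_carrier[OF rep(1) h] rep_carrier[OF rep(2) inv_closed[OF h]]
    have hu: "\<rho> h *\<^sub>v u \<in> carrier_vec d" by (rule rep_vec_carrier[OF rep(1) h u])
    have Ahu: "A *\<^sub>v (\<rho> h *\<^sub>v u) \<in> carrier_vec d'" using A hu by (rule mult_mat_vec_carrier)
    have "(\<rho>' (inv h) * A * \<rho> h) *\<^sub>v u = \<rho>' (inv h) *\<^sub>v (A *\<^sub>v (\<rho> h *\<^sub>v u))"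
      using assoc_mult_mat_vec[OF mult_carrier_mat[OF C(2) A] C(1) u]
        assoc_mult_mat_vec[OF C(2) A hu] by simp
    then show "((\<rho>' (inv h) * A * \<rho> h) *\<^sub>v u) \<bullet>c y = (A *\<^sub>v (\<rho> h *\<^sub>v u)) \<bullet>c (\<rho>' h *\<^sub>v y)"
      using rep_cscalar_prod[OF rep(2) inv_closed[OF h] Ahu y] h by simp
  qed
  finally show ?thesis .
qed

text \<open>Translating the summation index by \<open>k\<close> moves \<open>\<rho> k\<close> on the
  right of the sum to \<open>\<rho>' k\<close> on its left.\<close>

lemma intertwiner_averaged:
  assumes rep: "unitary_rep H d \<rho>" "unitary_rep H d' \<rho>'" and A: "A \<in> carrier_mat d' d"
  shows "intertwiner H d \<rho> d' \<rho>' (averaged d \<rho> d' \<rho>' A)"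
  unfolding intertwiner_def
proof (intro conjI ballI)
  let ?T = "averaged d \<rho> d' \<rho>' A"
  show T: "?T \<in> carrier_mat d' d" unfolding averaged_def by (rule msum_carrier)
  fix k assume k: "k \<in> carrier H"
  note C = rep_carrier[OF rep(1) k] rep_carrier[OF rep(2) k]
  show "?T * \<rho> k = \<rho>' k * ?T"
  proof (rule mat_eq_mult_vecI)
    fix u :: "complex vec" assume u: "u \<in> carrier_vec d"
    have ku: "\<rho> k *\<^sub>v u \<in> carrier_vec d" by (rule rep_vec_carrier[OF rep(1) k u])
    have Tu: "?T *\<^sub>v u \<in> carrier_vec d'" using T u by (rule mult_mat_vec_carrier)
    have "?T *\<^sub>v (\<rho> k *\<^sub>v u) = \<rho>' k *\<^sub>v (?T *\<^sub>v u)"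
    proof (rule vec_eq_cscalar_prodI)
      show "?T *\<^sub>v (\<rho> k *\<^sub>v u) \<in> carrier_vec d'" using T ku by (rule mult_mat_vec_carrier)
      show "\<rho>' k *\<^sub>v (?T *\<^sub>v u) \<in> carrier_vec d'" using C(2) Tu by (rule mult_mat_vec_carrier)
      fix y :: "complex vec" assume y: "y \<in> carrier_vec d'"
      have ky: "\<rho>' (inv k) *\<^sub>v y \<in> carrier_vec d'"
        by (rule rep_vec_carrier[OF rep(2) inv_closed[OF k] y])
      have "(?T *\<^sub>v (\<rho> k *\<^sub>v u)) \<bullet>c y
          = (\<Sum>h\<in>carrier H. (A *\<^sub>v (\<rho> h *\<^sub>v (\<rho> k *\<^sub>v u))) \<bullet>c (\<rho>' h *\<^sub>v y))"
        by (rule averaged_cscalar_prod[OF rep A ku y])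
      also have "\<dots> = (\<Sum>h\<in>carrier H. (A *\<^sub>v (\<rho> h *\<^sub>v u)) \<bullet>c (\<rho>' h *\<^sub>v (\<rho>' (inv k) *\<^sub>v y)))"
      proof (rule sum.reindex_bij_witness[of _ "\<lambda>h. h \<otimes> inv k" "\<lambda>h. h \<otimes> k"])
        fix h assume h: "h \<in> carrier H"
        show "(A *\<^sub>v (\<rho> (h \<otimes> k) *\<^sub>v u)) \<bullet>c (\<rho>' (h \<otimes> k) *\<^sub>v (\<rho>' (inv k) *\<^sub>v y))
            = (A *\<^sub>v (\<rho> h *\<^sub>v (\<rho> k *\<^sub>v u))) \<bullet>c (\<rho>' h *\<^sub>v y)"
          using rep_act[OF rep(1) h k u] rep_act[OF rep(2) _ _ y, of "h \<otimes> k" "inv k"] h k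
          by (simp add: m_assoc)
      qed (use k in \<open>auto simp: m_assoc\<close>)
      also have "\<dots> = (?T *\<^sub>v u) \<bullet>c (\<rho>' (inv k) *\<^sub>v y)"
        by (rule averaged_cscalar_prod[OF rep A u ky, symmetric])
      also have "\<dots> = (\<rho>' k *\<^sub>v (?T *\<^sub>v u)) \<bullet>c y"
        by (rule rep_cscalar_prod[OF rep(2) k Tu y, symmetric])
      finally show "(?T *\<^sub>v (\<rho> k *\<^sub>v u)) \<bullet>c y = (\<rho>' k *\<^sub>v (?T *\<^sub>v u)) \<bullet>c y" .
    qed
    then show "(?T * \<rho> k) *\<^sub>v u = (\<rho>' k * ?T) *\<^sub>v u"
      using assoc_mult_mat_vec[OF T C(1) u] assoc_mult_mat_vec[OF C(2) T u] by simp
  qed (use T C in auto)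
qed

lemma irreducible_repD:
  assumes "irreducible_rep H d \<rho>"
  shows "unitary_rep H d \<rho>" "0 < d"
  using assms unfolding irreducible_rep_def by auto

lemma irreducible_rep_subspace:
  assumes "irreducible_rep H d \<rho>"
    and "W \<subseteq> carrier_vec d" "0\<^sub>v d \<in> W"
    and "\<And>u v. u \<in> W \<Longrightarrow> v \<in> W \<Longrightarrow> u + v \<in> W"
    and "\<And>a u. u \<in> W \<Longrightarrow> a \<cdot>\<^sub>v u \<in> W"
    and "\<And>h u. h \<in> carrier H \<Longrightarrow> u \<in> W \<Longrightarrow> \<rho> h *\<^sub>v u \<in> W"
  shows "W = {0\<^sub>v d} \<or> W = carrier_vec d"
proof -
  have "VectorSpace.subspace class_ring W (module_vec TYPE(complex) d)"
    using assms(2-5) by (rule subspaceI)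
  moreover have "\<forall>h\<in>carrier H. \<forall>v\<in>W. \<rho> h *\<^sub>v v \<in> W"
    using assms(6) by simp
  ultimately show ?thesis
    using assms(1) unfolding irreducible_rep_def by simp
qed

text \<open>The kernel is an invariant subspace, and \<open>u\<close> keeps it from being
  everything. Here and in the next two lemmas \<open>T\<close> is shown to be non-zero by such a
  \<open>u\<close>, because the separation of eigenvectors produces one.\<close>

lemma intertwiner_injective:
  assumes irr: "irreducible_rep H d \<rho>" and rep: "unitary_rep H d' \<rho>'"
    and T: "intertwiner H d \<rho> d' \<rho>' T" and u: "u \<in> carrier_vec d" "T *\<^sub>v u \<noteq> 0\<^sub>v d'"
    and v: "v \<in> carrier_vec d" "T *\<^sub>v v = 0\<^sub>v d'"
  shows "v = 0\<^sub>v d"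
proof -
  note rep' = irreducible_repD(1)[OF irr]
  have TC: "T \<in> carrier_mat d' d" using T unfolding intertwiner_def by simp
  let ?W = "{v \<in> carrier_vec d. T *\<^sub>v v = 0\<^sub>v d'}"
  have "?W = {0\<^sub>v d} \<or> ?W = carrier_vec d"
  proof (rule irreducible_rep_subspace[OF irr])
    show "\<rho> h *\<^sub>v w \<in> ?W" if "h \<in> carrier H" "w \<in> ?W" for h w
      using that rep_vec_carrier[OF rep' that(1)] intertwiner_act[OF rep' rep T that(1)]
        rep_carrier[OF rep that(1)] by auto
  qed (use TC in \<open>auto simp: mult_add_distrib_mat_vec mult_mat_vec\<close>)
  then show ?thesis using u v by blast
qed

text \<open>Dually, the range is an invariant subspace of the target, which is now the irreducible
  side, and it contains the non-zero \<open>T u\<close>.\<close>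

lemma intertwiner_surjective:
  assumes rep: "unitary_rep H d \<rho>" and irr: "irreducible_rep H d' \<rho>'"
    and T: "intertwiner H d \<rho> d' \<rho>' T" and u: "u \<in> carrier_vec d" "T *\<^sub>v u \<noteq> 0\<^sub>v d'"
    and y: "y \<in> carrier_vec d'"
  shows "\<exists>x\<in>carrier_vec d. T *\<^sub>v x = y"
proof -
  note rep' = irreducible_repD(1)[OF irr]
  have TC: "T \<in> carrier_mat d' d" using T unfolding intertwiner_def by simp
  let ?W = "(\<lambda>x. T *\<^sub>v x) ` carrier_vec d"
  have "?W = {0\<^sub>v d'} \<or> ?W = carrier_vec d'"
  proof (rule irreducible_rep_subspace[OF irr])
    show "?W \<subseteq> carrier_vec d'" using TC by auto
    show "0\<^sub>v d' \<in> ?W" by (rule image_eqI[of _ _ "0\<^sub>v d"]) (use TC in auto)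
    show "a + b \<in> ?W" if ab: "a \<in> ?W" "b \<in> ?W" for a b
    proof -
      obtain x z where "x \<in> carrier_vec d" "z \<in> carrier_vec d" "a = T *\<^sub>v x" "b = T *\<^sub>v z"
        using ab by blast
      then show ?thesis using TC by (intro image_eqI[of _ _ "x + z"]) (auto simp: mult_add_distrib_mat_vec)
    qed
    show "c \<cdot>\<^sub>v a \<in> ?W" if a: "a \<in> ?W" for a c
    proof -
      obtain x where "x \<in> carrier_vec d" "a = T *\<^sub>v x" using a by blast
      then show ?thesis using TC by (intro image_eqI[of _ _ "c \<cdot>\<^sub>v x"]) (auto simp: mult_mat_vec)
    qed
    show "\<rho>' h *\<^sub>v a \<in> ?W" if h: "h \<in> carrier H" and a: "a \<in> ?W" for h a
    proof -
      obtain x where "x \<in> carrier_vec d" "a = T *\<^sub>v x" using a by blast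
      then show ?thesis
        using intertwiner_act[OF rep rep' T h] rep_vec_carrier[OF rep h]
        by (intro image_eqI[of _ _ "\<rho> h *\<^sub>v x"]) auto
    qed
  qed
  moreover have "T *\<^sub>v u \<in> ?W" using u(1) by (rule imageI)
  ultimately have "?W = carrier_vec d'" using u(2) by blast
  then have "y \<in> ?W" using y by simp
  then show ?thesis by blast
qed

lemma Schur_rep_iso:
  assumes irr: "irreducible_rep H d \<rho>" "irreducible_rep H d' \<rho>'"
    and T: "intertwiner H d \<rho> d' \<rho>' T" and u: "u \<in> carrier_vec d" "T *\<^sub>v u \<noteq> 0\<^sub>v d'"
  shows "rep_iso H d \<rho> d' \<rho>'"
proof -
  note rep = irreducible_repD(1)[OF irr(1)] irreducible_repD(1)[OF irr(2)]
  have TC: "T \<in> carrier_mat d' d" using T unfolding intertwiner_def by simp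
  have "\<forall>i. \<exists>x. x \<in> carrier_vec d \<and> T *\<^sub>v x = unit_vec d' i"
    using intertwiner_surjective[OF rep(1) irr(2) T u] unit_vec_carrier by blast
  then obtain x where x: "\<And>i. x i \<in> carrier_vec d" "\<And>i. T *\<^sub>v x i = unit_vec d' i"
    by metis
  \<comment> \<open>Preimages of the unit vectors serve as columns, so \<open>S\<close> is a right
    inverse at once. That it is a left inverse follows from the injectivity of \<open>T\<close> at
    \<open>S T w - w\<close>.\<close>
  define S where "S = mat_of_cols d (map x [0..<d'])"
  have SC: "S \<in> carrier_mat d d'" unfolding S_def by auto
  have colS: "col S i = x i" if "i < d'" for i
    using that x(1)[of i] unfolding S_def by (subst col_mat_of_cols) auto
  have TS: "T * S = 1\<^sub>m d'"
  proof (rule eq_matI)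
    fix i j assume ij: "i < dim_row (1\<^sub>m d' :: complex mat)" "j < dim_col (1\<^sub>m d' :: complex mat)"
    have "(T * S) $$ (i, j) = (T *\<^sub>v col S j) $ i" using ij TC SC by simp
    then show "(T * S) $$ (i, j) = 1\<^sub>m d' $$ (i, j)" using ij x(2)[of j] by (simp add: colS)
  qed (use TC SC in auto)
  have ST: "S * T = 1\<^sub>m d"
  proof (rule mat_eq_mult_vecI[OF mult_carrier_mat[OF SC TC] one_carrier_mat])
    fix w :: "complex vec" assume w: "w \<in> carrier_vec d"
    have Tw: "T *\<^sub>v w \<in> carrier_vec d'" using TC w by (rule mult_mat_vec_carrier)
    have STw: "S *\<^sub>v (T *\<^sub>v w) \<in> carrier_vec d" using SC Tw by (rule mult_mat_vec_carrier)
    have "T *\<^sub>v (S *\<^sub>v (T *\<^sub>v w)) = T *\<^sub>v w"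
      using assoc_mult_mat_vec[OF TC SC Tw] TS Tw by simp
    then have "T *\<^sub>v (S *\<^sub>v (T *\<^sub>v w) - w) = 0\<^sub>v d'"
      using TC STw w Tw by (simp add: mult_minus_distrib_mat_vec)
    then have "S *\<^sub>v (T *\<^sub>v w) - w = 0\<^sub>v d"
      using intertwiner_injective[OF irr(1) rep(2) T u] STw w by simp
    then have "S *\<^sub>v (T *\<^sub>v w) = w"
      by (rule vec_minus_eq_zeroD[OF STw w])
    then show "(S * T) *\<^sub>v w = 1\<^sub>m d *\<^sub>v w"
      using assoc_mult_mat_vec[OF SC TC w] w by simp
  qed
  have "d' = d" by (rule square_of_two_sided_inverse[OF TC SC TS ST])
  then have "invertible_mat T"
    unfolding invertible_mat_def inverts_mat_def using TC SC TS ST by auto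
  then show ?thesis
    using T unfolding rep_iso_iff_intertwiner by blast
qed

text \<open>Squareness in \<open>invertible_mat\<close> gives the equality of dimensions. The
  inverse intertwines in the other direction by
  \<open>S \<rho>' = S \<rho>' T S = S T \<rho> S = \<rho> S\<close>.\<close>

lemma rep_iso_dim:
  assumes rep: "unitary_rep H d \<rho>" "unitary_rep H d' \<rho>'" and iso: "rep_iso H d \<rho> d' \<rho>'"
  obtains T S where "d' = d" "intertwiner H d \<rho> d \<rho>' T" "intertwiner H d \<rho>' d \<rho> S"
    "S * T = 1\<^sub>m d" "T * S = 1\<^sub>m d"
proof -
  obtain T where T: "intertwiner H d \<rho> d' \<rho>' T" "invertible_mat T"
    using iso unfolding rep_iso_iff_intertwiner by blast
  then have TC: "T \<in> carrier_mat d' d" unfolding intertwiner_def by simp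
  then have d: "d' = d" using T(2) unfolding invertible_mat_def by simp
  note TC = TC[unfolded d]
  obtain S where S: "T * S = 1\<^sub>m d" "S * T = 1\<^sub>m (dim_row S)"
    using T(2) TC unfolding invertible_mat_def inverts_mat_def by auto
  have "dim_col S = d" using arg_cong[OF S(1), of dim_col] by simp
  moreover have "dim_row S = d" using arg_cong[OF S(2), of dim_col] TC by simp
  ultimately have SC: "S \<in> carrier_mat d d" by auto
  have "S * \<rho>' h = \<rho> h * S" if h: "h \<in> carrier H" for h
  proof -
    note C = rep_carrier[OF rep(1) h] rep_carrier[OF rep(2) h, unfolded d]
    have "S * \<rho>' h = S * (\<rho>' h * (T * S))"
      using C S by simp
    also have "\<rho>' h * (T * S) = T * \<rho> h * S"
      using T(1) h assoc_mult_mat[OF C(2) TC SC] unfolding intertwiner_def by simp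
    also have "S * (T * \<rho> h * S) = S * T * \<rho> h * S"
      using assoc_mult_mat[OF SC TC C(1)] assoc_mult_mat[OF SC mult_carrier_mat[OF TC C(1)] SC] by simp
    also have "\<dots> = \<rho> h * S"
      using S(2) SC C(1) by simp
    finally show ?thesis .
  qed
  then have "intertwiner H d \<rho>' d \<rho> S"
    using SC unfolding intertwiner_def by blast
  then show thesis
    using that[of T S] T(1) S SC d by simp
qed

end

section \<open>Dual representations\<close>

lemma map_cnj_mult_vec:
  assumes "A \<in> carrier_mat m n" "u \<in> carrier_vec n"
  shows "map_mat cnj A *\<^sub>v conjugate u = conjugate (A *\<^sub>v u)"
  using assms by (intro eq_vecI) (auto simp: scalar_prod_def)

lemma map_cnj_mult:
  assumes "A \<in> carrier_mat m n" "B \<in> carrier_mat n k"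
  shows "map_mat cnj (A * B) = map_mat cnj A * map_mat cnj B"
  using assms by (intro eq_matI) (auto simp: scalar_prod_def)

text \<open>Conjugating an eigenvector equation leaves a real eigenvalue alone. The reverse
  inclusion is the same fact for the conjugate matrix, conjugation being an involution.\<close>

lemma real_eigenvalues_map_cnj:
  assumes A: "A \<in> carrier_mat d d"
  shows "real_eigenvalues (map_mat cnj A) = real_eigenvalues A"
proof -
  have sub: "real_eigenvalues B \<subseteq> real_eigenvalues (map_mat cnj B)" if B: "B \<in> carrier_mat d d" for B
  proof
    fix l assume "l \<in> real_eigenvalues B"
    then obtain v where v: "v \<in> carrier_vec d" "v \<noteq> 0\<^sub>v d" "B *\<^sub>v v = complex_of_real l \<cdot>\<^sub>v v"
      using B unfolding real_eigenvalues_def eigenvector_def by auto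
    have "map_mat cnj B *\<^sub>v conjugate v = complex_of_real l \<cdot>\<^sub>v conjugate v"
      using map_cnj_mult_vec[OF B v(1)] v(3) by (simp add: conjugate_smult_vec)
    then have "eigenvector (map_mat cnj B) (conjugate v) (complex_of_real l)"
      using v B unfolding eigenvector_def by auto
    then show "l \<in> real_eigenvalues (map_mat cnj B)"
      unfolding real_eigenvalues_def by blast
  qed
  have "map_mat cnj (map_mat cnj A) = A" by (intro eq_matI) auto
  then show ?thesis using sub[of A] sub[of "map_mat cnj A"] A by auto
qed

lemma mat_adjoint_cscalar_prod':
  fixes A :: "complex mat"
  assumes A: "A \<in> carrier_mat d e" and u: "u \<in> carrier_vec e" and w: "w \<in> carrier_vec d"
  shows "(mat_adjoint A *\<^sub>v w) \<bullet>c u = w \<bullet>c (A *\<^sub>v u)"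
proof -
  have C: "mat_adjoint A *\<^sub>v w \<in> carrier_vec e" "A *\<^sub>v u \<in> carrier_vec d"
    using mult_mat_vec_carrier[OF mat_adjoint_carrier[OF A] w] mult_mat_vec_carrier[OF A u] by auto
  show ?thesis
    using arg_cong[OF mat_adjoint_cscalar_prod[OF A u w], of cnj]
      cscalar_prod_cnj[OF C(2) w] cscalar_prod_cnj[OF u C(1)] by simp
qed

lemma orth_compl_zero: "orth_compl d {0\<^sub>v d} = carrier_vec d"
  unfolding orth_compl_def by auto

lemma mult_mat_zero_vec:
  "A \<in> carrier_mat m n \<Longrightarrow> A *\<^sub>v 0\<^sub>v n = (0\<^sub>v m :: complex vec)"
  by auto

lemma fixed_spaceD:
  assumes "v \<in> fixed_space K d \<rho>"
  shows "v \<in> carrier_vec d" "\<And>h. h \<in> K \<Longrightarrow> \<rho> h *\<^sub>v v = v"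
  using assms unfolding fixed_space_def by auto

context finite_group
begin

lemma zero_in_fixed_space:
  assumes "unitary_rep H d \<rho>"
  shows "0\<^sub>v d \<in> fixed_space (carrier H) d \<rho>"
  using mult_mat_zero_vec[OF rep_carrier[OF assms]] unfolding fixed_space_def by simp

text \<open>The inverse of a unitary matrix is its adjoint, so the transposed inverse is the
  entrywise conjugate. The dual is therefore handled as \<open>\<rho>\<close> seen through
  conjugation of vectors.\<close>

lemma dual_rep_eq:
  assumes "unitary_rep H d \<rho>" "h \<in> carrier H"
  shows "dual_rep H \<rho> h = map_mat cnj (\<rho> h)"
  using rep_carrier[OF assms] mat_adjoint_carrier[OF rep_carrier[OF assms]]
    mat_adjoint_index[OF rep_carrier[OF assms]]
  unfolding dual_rep_def rep_inv[OF assms] by (intro eq_matI) auto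

lemma dual_rep_act:
  assumes "unitary_rep H d \<rho>" "h \<in> carrier H" "u \<in> carrier_vec d"
  shows "dual_rep H \<rho> h *\<^sub>v conjugate u = conjugate (\<rho> h *\<^sub>v u)"
  using map_cnj_mult_vec[OF rep_carrier[OF assms(1,2)] assms(3)] dual_rep_eq[OF assms(1,2)] by simp

lemma unitary_dual_rep:
  assumes rep: "unitary_rep H d \<rho>"
  shows "unitary_rep H d (dual_rep H \<rho>)"
  unfolding unitary_rep_def
proof (rule homI)
  fix h assume h: "h \<in> carrier H"
  note C = rep_carrier[OF rep h] and U = rep_unitary[OF rep h]
  note C' = mat_adjoint_carrier[OF C]
  have one: "map_mat cnj (1\<^sub>m d) = 1\<^sub>m d" by (intro eq_matI) auto
  have "mat_adjoint (map_mat cnj (\<rho> h)) = map_mat cnj (mat_adjoint (\<rho> h))"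
    using C C' mat_adjoint_carrier[of "map_mat cnj (\<rho> h)" d d]
    by (intro eq_matI) (auto simp: mat_adjoint_index[of _ d d])
  then show "dual_rep H \<rho> h \<in> carrier (unitary_group d)"
    using map_cnj_mult[OF C C'] map_cnj_mult[OF C' C] U one C
    unfolding unitary_group_def dual_rep_eq[OF rep h] by auto
next
  fix h k assume h: "h \<in> carrier H" and k: "k \<in> carrier H"
  show "dual_rep H \<rho> (h \<otimes> k) = dual_rep H \<rho> h \<otimes>\<^bsub>unitary_group d\<^esub> dual_rep H \<rho> k"
    using h k map_cnj_mult[OF rep_carrier[OF rep h] rep_carrier[OF rep k]]
    by (simp add: dual_rep_eq[OF rep] rep_mult[OF rep] unitary_group_def)
qed

lemma irreducible_dual_rep:
  assumes irr: "irreducible_rep H d \<rho>"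
  shows "irreducible_rep H d (dual_rep H \<rho>)"
  unfolding irreducible_rep_def
proof (intro conjI allI impI)
  note rep = irreducible_repD(1)[OF irr]
  show "unitary_rep H d (dual_rep H \<rho>)" by (rule unitary_dual_rep[OF rep])
  show "0 < d" by (rule irreducible_repD(2)[OF irr])
  fix W assume "VectorSpace.subspace class_ring W (module_vec TYPE(complex) d)"
  note W = subspaceD[OF this]
  assume inv: "\<forall>h\<in>carrier H. \<forall>v\<in>W. dual_rep H \<rho> h *\<^sub>v v \<in> W"
  \<comment> \<open>The preimage of \<open>W\<close> under conjugation is again a complex subspace,
    although conjugation is only conjugate-linear.\<close>
  let ?W = "{u. conjugate u \<in> W}"
  have "?W = {0\<^sub>v d} \<or> ?W = carrier_vec d"
  proof (rule irreducible_rep_subspace[OF irr])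
    show sub: "?W \<subseteq> carrier_vec d"
    proof
      fix u :: "complex vec" assume "u \<in> ?W"
      then have "conjugate u \<in> carrier_vec d" using W(1) by auto
      then show "u \<in> carrier_vec d" using carrier_vec_conjugate by fastforce
    qed
    show "0\<^sub>v d \<in> ?W" using W(2) by simp
    show "u + v \<in> ?W" if "u \<in> ?W" "v \<in> ?W" for u v
      using that W(3) conjugate_add_vec[OF subsetD[OF sub that(1)] subsetD[OF sub that(2)]] by simp
    show "a \<cdot>\<^sub>v u \<in> ?W" if "u \<in> ?W" for a u
      using that W(4) by (simp add: conjugate_smult_vec)
    show "\<rho> h *\<^sub>v u \<in> ?W" if "h \<in> carrier H" "u \<in> ?W" for h u
    proof -
      have "dual_rep H \<rho> h *\<^sub>v conjugate u \<in> W" using inv that by simp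
      then show ?thesis using dual_rep_act[OF rep that(1) subsetD[OF sub that(2)]] by simp
    qed
  qed
  moreover have "W = conjugate ` ?W"
    by (force intro: image_eqI[of _ _ "conjugate _"])
  moreover have "conjugate ` carrier_vec d = (carrier_vec d :: complex vec set)"
    by (force intro: image_eqI[of _ _ "conjugate _"])
  ultimately show "W = {0\<^sub>v d} \<or> W = carrier_vec d"
    by (metis conjugate_zero_vec image_empty image_insert)
qed

lemma fixed_space_dual_rep:
  assumes rep: "unitary_rep H d \<rho>" and triv: "fixed_space (carrier H) d \<rho> = {0\<^sub>v d}"
  shows "fixed_space (carrier H) d (dual_rep H \<rho>) = {0\<^sub>v d}"
proof -
  have "v = 0\<^sub>v d" if v: "v \<in> fixed_space (carrier H) d (dual_rep H \<rho>)" for v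
  proof -
    note vD = fixed_spaceD[OF v]
    have c: "conjugate v \<in> carrier_vec d" using vD(1) by simp
    have "\<rho> h *\<^sub>v conjugate v = conjugate v" if h: "h \<in> carrier H" for h
      using dual_rep_act[OF rep h c] vD(2)[OF h] by (metis conjugate_id)
    then have "conjugate v \<in> fixed_space (carrier H) d \<rho>"
      using c unfolding fixed_space_def by simp
    then show ?thesis using triv vD(1) by simp
  qed
  moreover have "0\<^sub>v d \<in> fixed_space (carrier H) d (dual_rep H \<rho>)"
    by (rule zero_in_fixed_space[OF unitary_dual_rep[OF rep]])
  ultimately show ?thesis by blast
qed

text \<open>The weights \<open>w\<close> are real, so conjugating every \<open>\<rho> h\<close>
  conjugates the whole operator.\<close>

lemma real_eigenvalues_dual_rep:
  assumes "unitary_rep H d \<rho>"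
  shows "real_eigenvalues (ga_rep H d (dual_rep H \<rho>) w) = real_eigenvalues (ga_rep H d \<rho> w)"
proof -
  have "ga_rep H d (dual_rep H \<rho>) w = map_mat cnj (ga_rep H d \<rho> w)"
    unfolding ga_rep_def using rep_carrier[OF assms] dual_rep_eq[OF assms]
    by (intro eq_matI) (auto intro!: sum.cong, metis carrier_matD index_map_mat(1))
  then show ?thesis
    using real_eigenvalues_map_cnj[OF ga_rep_carrier] by simp
qed

section \<open>Fixed vectors of irreducible representations and the value of
  \<open>psi\<close>\<close>

lemma fixed_space_irreducible:
  assumes irr: "irreducible_rep H d \<rho>"
  shows "fixed_space (carrier H) d \<rho> = {0\<^sub>v d} \<or> fixed_space (carrier H) d \<rho> = carrier_vec d"
proof (rule irreducible_rep_subspace[OF irr])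
  note rep = irreducible_repD(1)[OF irr]
  show "u + v \<in> fixed_space (carrier H) d \<rho>"
    if "u \<in> fixed_space (carrier H) d \<rho>" "v \<in> fixed_space (carrier H) d \<rho>" for u v
    using that rep_carrier[OF rep] unfolding fixed_space_def
    by (auto simp: mult_add_distrib_mat_vec[of _ d d])
  show "a \<cdot>\<^sub>v u \<in> fixed_space (carrier H) d \<rho>" if "u \<in> fixed_space (carrier H) d \<rho>" for a u
    using that rep_carrier[OF rep] unfolding fixed_space_def
    by (auto simp: mult_mat_vec[of _ d d])
  show "\<rho> h *\<^sub>v u \<in> fixed_space (carrier H) d \<rho>"
    if "h \<in> carrier H" "u \<in> fixed_space (carrier H) d \<rho>" for h u
    using that unfolding fixed_space_def by auto
  show "0\<^sub>v d \<in> fixed_space (carrier H) d \<rho>" by (rule zero_in_fixed_space[OF rep])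
qed (auto simp: fixed_space_def)

text \<open>Otherwise the group acts as the identity, every line is invariant, irreducibility forces
  dimension one, and \<open>\<rho>\<close> is the trivial representation.\<close>

lemma fixed_space_nontrivial:
  assumes irr: "irreducible_rep H d \<rho>" and nt: "\<not> rep_iso H d \<rho> 1 trivial_rep"
  shows "fixed_space (carrier H) d \<rho> = {0\<^sub>v d}"
proof (rule ccontr)
  note rep = irreducible_repD(1)[OF irr]
  assume "\<not> ?thesis"
  then have "fixed_space (carrier H) d \<rho> = carrier_vec d"
    using fixed_space_irreducible[OF irr] by blast
  then have fix_all: "\<rho> h *\<^sub>v u = u" if "h \<in> carrier H" "u \<in> carrier_vec d" for h u
    using that fixed_spaceD(2)[of u "carrier H" d \<rho>] by simp
  let ?e = "unit_vec d 0 :: complex vec"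
  let ?W = "{a \<cdot>\<^sub>v ?e | a. True}"
  have "?W = {0\<^sub>v d} \<or> ?W = carrier_vec d"
  proof (rule irreducible_rep_subspace[OF irr])
    show "0\<^sub>v d \<in> ?W" by (auto intro!: exI[of _ 0])
    show "u + v \<in> ?W" if uv: "u \<in> ?W" "v \<in> ?W" for u v
    proof -
      obtain a b where "u = a \<cdot>\<^sub>v ?e" "v = b \<cdot>\<^sub>v ?e" using uv by blast
      then show ?thesis by (auto simp: add_smult_distrib_vec[symmetric])
    qed
    show "c \<cdot>\<^sub>v u \<in> ?W" if "u \<in> ?W" for c u
      using that by (auto simp: smult_smult_assoc)
    show "\<rho> h *\<^sub>v u \<in> ?W" if "h \<in> carrier H" "u \<in> ?W" for h u
      using that fix_all[OF that(1)] by auto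
  qed auto
  moreover have "0 < d" by (rule irreducible_repD(2)[OF irr])
  moreover have "?e \<in> ?W" by (auto intro!: exI[of _ 1])
  moreover have "?e \<noteq> 0\<^sub>v d"
    using \<open>0 < d\<close> by (metis index_unit_vec(1) index_zero_vec(1) zero_neq_one)
  ultimately have W: "?W = carrier_vec d" by blast
  have "d = 1"
  proof (rule ccontr)
    assume "d \<noteq> 1"
    then have d: "1 < d" using \<open>0 < d\<close> by simp
    obtain a where "unit_vec d 1 = a \<cdot>\<^sub>v ?e" using W unit_vec_carrier[of d 1] by blast
    then have "unit_vec d 1 $ 1 = (a \<cdot>\<^sub>v ?e) $ 1" by simp
    then show False using d by simp
  qed
  have "intertwiner H d \<rho> 1 trivial_rep (1\<^sub>m 1)"
    unfolding intertwiner_def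
  proof (intro conjI ballI)
    fix h assume h: "h \<in> carrier H"
    have "\<rho> h = 1\<^sub>m 1"
      using rep_carrier[OF rep h] fix_all[OF h] unfolding \<open>d = 1\<close>
      by (intro mat_eq_mult_vecI[of _ 1 1]) auto
    then show "1\<^sub>m 1 * \<rho> h = trivial_rep h * 1\<^sub>m 1" unfolding trivial_rep_def by simp
  qed (simp add: \<open>d = 1\<close>)
  moreover have "invertible_mat (1\<^sub>m 1 :: complex mat)"
    unfolding invertible_mat_def inverts_mat_def by (auto intro!: exI[of _ "1\<^sub>m 1"])
  ultimately show False using nt unfolding rep_iso_iff_intertwiner by blast
qed

text \<open>Orthogonality to the zero space is no condition, so \<open>psi\<close> becomes the
  bottom of the full real spectrum, which is also preserved by isomorphisms that are not
  unitary.\<close>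

lemma psi_eq_Min:
  assumes "0 < d" "fixed_space (carrier H) d \<rho> = {0\<^sub>v d}"
  shows "psi H w d \<rho> = ereal (Min (real_eigenvalues (ga_rep H d \<rho> (ga_Delta H w))))"
proof -
  have "unit_vec d 0 \<noteq> (0\<^sub>v d :: complex vec)"
    using assms(1) by (metis index_unit_vec(1) index_zero_vec(1) zero_neq_one)
  then have "{0\<^sub>v d} \<noteq> (carrier_vec d :: complex vec set)"
    using unit_vec_carrier[of d 0] by blast
  moreover have "(\<exists>v\<in>carrier_vec d. eigenvector (ga_rep H d \<rho> (ga_Delta H w)) v l)
      \<longleftrightarrow> (\<exists>v. eigenvector (ga_rep H d \<rho> (ga_Delta H w)) v l)" for l
    using ga_rep_carrier[of d \<rho> "ga_Delta H w"] unfolding eigenvector_def by auto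
  ultimately show ?thesis
    unfolding psi_def assms(2) orth_compl_zero real_eigenvalues_def by simp
qed

text \<open>An isomorphism need not be unitary and so need not respect orthogonal complements. What
  it does transport is the vanishing of the fixed space and the spectrum, and these determine
  \<open>psi\<close> by \<open>psi_eq_Min\<close>.\<close>

lemma
  assumes rep: "unitary_rep H d \<rho>" "unitary_rep H d' \<rho>'" and iso: "rep_iso H d \<rho> d' \<rho>'"
  shows rep_iso_fixed_space:
      "fixed_space (carrier H) d' \<rho>' = {0\<^sub>v d'} \<Longrightarrow> fixed_space (carrier H) d \<rho> = {0\<^sub>v d}"
    and rep_iso_real_eigenvalues:
      "real_eigenvalues (ga_rep H d \<rho> w) = real_eigenvalues (ga_rep H d' \<rho>' w)"
proof -
  obtain T S where d: "d' = d" and T: "intertwiner H d \<rho> d \<rho>' T" and S: "intertwiner H d \<rho>' d \<rho> S"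
    and inv: "S * T = 1\<^sub>m d" "T * S = 1\<^sub>m d"
    by (rule rep_iso_dim[OF assms])
  note rep = rep[unfolded d]
  have C: "T \<in> carrier_mat d d" "S \<in> carrier_mat d d"
    using T S unfolding intertwiner_def by auto
  have STu: "S *\<^sub>v (T *\<^sub>v u) = u" if "u \<in> carrier_vec d" for u
    using that assoc_mult_mat_vec[OF C(2,1) that] inv by simp
  have TSu: "T *\<^sub>v (S *\<^sub>v u) = u" if "u \<in> carrier_vec d" for u
    using that assoc_mult_mat_vec[OF C that] inv by simp
  have Tnz: "T *\<^sub>v u \<noteq> 0\<^sub>v d" if "u \<in> carrier_vec d" "u \<noteq> 0\<^sub>v d" for u
    using STu[OF that(1)] that(2) mult_mat_zero_vec[OF C(2)] by auto
  have Snz: "S *\<^sub>v u \<noteq> 0\<^sub>v d" if "u \<in> carrier_vec d" "u \<noteq> 0\<^sub>v d" for u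
    using TSu[OF that(1)] that(2) mult_mat_zero_vec[OF C(1)] by auto
  show "fixed_space (carrier H) d \<rho> = {0\<^sub>v d}" if triv: "fixed_space (carrier H) d' \<rho>' = {0\<^sub>v d'}"
  proof -
    have "v = 0\<^sub>v d" if v: "v \<in> fixed_space (carrier H) d \<rho>" for v
    proof -
      note vD = fixed_spaceD[OF v]
      have "T *\<^sub>v v \<in> fixed_space (carrier H) d \<rho>'"
        using vD C mult_mat_vec_carrier[OF C(1) vD(1)] intertwiner_act[OF rep T _ vD(1)]
        unfolding fixed_space_def by auto
      then show ?thesis using triv Tnz[OF vD(1)] unfolding d by blast
    qed
    moreover have "0\<^sub>v d \<in> fixed_space (carrier H) d \<rho>"
      by (rule zero_in_fixed_space[OF rep(1)])
    ultimately show ?thesis by blast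
  qed
  have ev: "u \<in> carrier_vec d \<and> u \<noteq> 0\<^sub>v d" if "eigenvector (ga_rep H d \<sigma> w) u l" for \<sigma> u l
    using that ga_rep_carrier[of d \<sigma> w] unfolding eigenvector_def by auto
  show "real_eigenvalues (ga_rep H d \<rho> w) = real_eigenvalues (ga_rep H d' \<rho>' w)"
    unfolding d real_eigenvalues_def
    using intertwiner_eigenvector[OF rep T] intertwiner_eigenvector[OF rep(2,1) S] ev Tnz Snz
    by blast
qed

section \<open>The regular representation\<close>

lemma elem_enum_bij: "bij_betw (elem_enum H) {0..<Coset.order H} (carrier H)"
proof -
  have "\<exists>e. bij_betw e {0..<Coset.order H} (carrier H)"
    using finite_same_card_bij[of "{0..<Coset.order H}" "carrier H"] finite_carrier
    unfolding Coset.order_def by simp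
  then show ?thesis unfolding elem_enum_def by (rule someI_ex)
qed

lemma elem_enum_carrier: "i < Coset.order H \<Longrightarrow> elem_enum H i \<in> carrier H"
  using bij_betwE[OF elem_enum_bij] by simp

text \<open>A function on the group as a vector in the basis \<open>carrier H\<close>. Through
  \<open>reg_rep_coord_vec\<close> the enumeration disappears and the regular representation becomes
  left translation of functions.\<close>

definition coord_vec :: "('h \<Rightarrow> complex) \<Rightarrow> complex vec" where
  "coord_vec f = vec (Coset.order H) (\<lambda>i. f (elem_enum H i))"

lemma coord_vec_surj:
  assumes "u \<in> carrier_vec (Coset.order H)"
  obtains f where "u = coord_vec f"
proof
  let ?g = "the_inv_into {0..<Coset.order H} (elem_enum H)"
  show "u = coord_vec (\<lambda>h. u $ ?g h)"
    using assms the_inv_into_f_f[OF bij_betw_imp_inj_on[OF elem_enum_bij]]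
    unfolding coord_vec_def by (intro eq_vecI) auto
qed

lemma coord_vec_inject:
  "coord_vec f = coord_vec g \<Longrightarrow> h \<in> carrier H \<Longrightarrow> f h = g h"
proof -
  assume eq: "coord_vec f = coord_vec g" and h: "h \<in> carrier H"
  obtain i where "i < Coset.order H" "h = elem_enum H i"
    using h bij_betw_imp_surj_on[OF elem_enum_bij] by (metis atLeastLessThan_iff imageE)
  then show "f h = g h"
    using arg_cong[OF eq, of "\<lambda>v. v $ i"] unfolding coord_vec_def by simp
qed

lemma reg_rep_carrier: "reg_rep H h \<in> carrier_mat (Coset.order H) (Coset.order H)"
  unfolding reg_rep_def by simp

lemma reg_rep_coord_vec:
  assumes h: "h \<in> carrier H"
  shows "reg_rep H h *\<^sub>v coord_vec f = coord_vec (\<lambda>x. f (inv h \<otimes> x))"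
proof (rule eq_vecI)
  fix i assume "i < dim_vec (coord_vec (\<lambda>x. f (inv h \<otimes> x)))"
  then have i: "i < Coset.order H" unfolding coord_vec_def by simp
  let ?N = "Coset.order H" and ?e = "elem_enum H"
  have "inv h \<otimes> ?e i \<in> carrier H" using h elem_enum_carrier[OF i] by simp
  \<comment> \<open>Row \<open>i\<close> of \<open>reg_rep H h\<close> has its only non-zero entry
    in this column \<open>k\<close>.\<close>
  then obtain k where k: "k < ?N" "?e k = inv h \<otimes> ?e i"
    using elem_enum_bij unfolding bij_betw_def by force
  have iff: "?e i = h \<otimes> ?e j \<longleftrightarrow> j = k" if j: "j < ?N" for j
  proof -
    have "?e i = h \<otimes> ?e j \<longleftrightarrow> ?e j = ?e k"
      using k h elem_enum_carrier[OF i] elem_enum_carrier[OF j]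
      by (metis inv_solve_left)
    also have "\<dots> \<longleftrightarrow> j = k"
      using inj_on_eq_iff[OF bij_betw_imp_inj_on[OF elem_enum_bij], of j k] j k by simp
    finally show ?thesis .
  qed
  have "(reg_rep H h *\<^sub>v coord_vec f) $ i
      = (\<Sum>j = 0..<?N. (if ?e i = h \<otimes> ?e j then 1 else 0) * f (?e j))"
    using i unfolding reg_rep_def coord_vec_def by (simp add: scalar_prod_def)
  also have "\<dots> = (\<Sum>j = 0..<?N. if j = k then f (?e j) else 0)"
    by (intro sum.cong refl) (simp add: iff)
  also have "\<dots> = f (inv h \<otimes> ?e i)"
    using k by simp
  finally show "(reg_rep H h *\<^sub>v coord_vec f) $ i = coord_vec (\<lambda>x. f (inv h \<otimes> x)) $ i"
    using i unfolding coord_vec_def by simp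
qed (simp add: reg_rep_def coord_vec_def)

lemma coord_vec_cong: "(\<And>h. h \<in> carrier H \<Longrightarrow> f h = g h) \<Longrightarrow> coord_vec f = coord_vec g"
  unfolding coord_vec_def using elem_enum_carrier by (intro eq_vecI) auto

lemma unitary_reg_rep: "unitary_rep H (Coset.order H) (reg_rep H)"
  unfolding unitary_rep_def
proof (rule homI)
  let ?N = "Coset.order H"
  have mult: "reg_rep H (h \<otimes> k) = reg_rep H h * reg_rep H k"
    if h: "h \<in> carrier H" and k: "k \<in> carrier H" for h k
  proof (rule mat_eq_mult_vecI[OF reg_rep_carrier mult_carrier_mat[OF reg_rep_carrier reg_rep_carrier]])
    fix u :: "complex vec" assume u: "u \<in> carrier_vec ?N"
    obtain f where f: "u = coord_vec f" by (rule coord_vec_surj[OF u])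
    have "reg_rep H (h \<otimes> k) *\<^sub>v u = reg_rep H h *\<^sub>v (reg_rep H k *\<^sub>v u)"
      using h k unfolding f
      by (simp add: reg_rep_coord_vec) (auto intro!: coord_vec_cong simp: inv_mult_group m_assoc)
    then show "reg_rep H (h \<otimes> k) *\<^sub>v u = reg_rep H h * reg_rep H k *\<^sub>v u"
      using assoc_mult_mat_vec[OF reg_rep_carrier reg_rep_carrier u] by simp
  qed
  have one: "reg_rep H \<one> = 1\<^sub>m ?N"
  proof (rule mat_eq_mult_vecI[OF reg_rep_carrier one_carrier_mat])
    fix u :: "complex vec" assume u: "u \<in> carrier_vec ?N"
    obtain f where f: "u = coord_vec f" by (rule coord_vec_surj[OF u])
    show "reg_rep H \<one> *\<^sub>v u = 1\<^sub>m ?N *\<^sub>v u"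
      using u unfolding f by (simp add: reg_rep_coord_vec) (auto intro!: coord_vec_cong)
  qed
  fix h assume h: "h \<in> carrier H"
  have "mat_adjoint (reg_rep H h) = reg_rep H (inv h)"
  proof (rule eq_matI)
    fix i j assume "i < dim_row (reg_rep H (inv h))" "j < dim_col (reg_rep H (inv h))"
    then have ij: "i < ?N" "j < ?N" unfolding reg_rep_def by auto
    have "elem_enum H j = h \<otimes> elem_enum H i \<longleftrightarrow> elem_enum H i = inv h \<otimes> elem_enum H j"
      using h elem_enum_carrier[OF ij(1)] elem_enum_carrier[OF ij(2)] by (metis inv_solve_left)
    then show "mat_adjoint (reg_rep H h) $$ (i, j) = reg_rep H (inv h) $$ (i, j)"
      unfolding mat_adjoint_index[OF reg_rep_carrier ij] using ij by (simp add: reg_rep_def)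
  qed (use mat_adjoint_carrier[OF reg_rep_carrier, of h] reg_rep_carrier[of "inv h"] in auto)
  then show "reg_rep H h \<in> carrier (unitary_group ?N)"
    using mult[of h "inv h"] mult[of "inv h" h] one h reg_rep_carrier[of h]
    unfolding unitary_group_def by simp
  fix k assume "k \<in> carrier H"
  then show "reg_rep H (h \<otimes> k) = reg_rep H h \<otimes>\<^bsub>unitary_group ?N\<^esub> reg_rep H k"
    using mult[OF h] unfolding unitary_group_def by simp
qed

text \<open>The adjoint of an intertwiner intertwines in the opposite direction. Consequently a
  representation without fixed vectors is mapped into the orthogonal complement of the fixed vectors
  of its target, the space on which \<open>psi\<close> is measured.\<close>

lemma intertwiner_adjoint_fixed:
  assumes rep: "unitary_rep H d \<rho>" "unitary_rep H d' \<rho>'" and T: "intertwiner H d \<rho> d' \<rho>' T"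
    and u: "u \<in> fixed_space (carrier H) d' \<rho>'"
  shows "mat_adjoint T *\<^sub>v u \<in> fixed_space (carrier H) d \<rho>"
proof -
  have TC: "T \<in> carrier_mat d' d" using T unfolding intertwiner_def by simp
  note uD = fixed_spaceD[OF u]
  have Tu: "mat_adjoint T *\<^sub>v u \<in> carrier_vec d"
    using mat_adjoint_carrier[OF TC] uD(1) by (rule mult_mat_vec_carrier)
  have "\<rho> h *\<^sub>v (mat_adjoint T *\<^sub>v u) = mat_adjoint T *\<^sub>v u" if h: "h \<in> carrier H" for h
  proof (rule vec_eq_cscalar_prodI[OF rep_vec_carrier[OF rep(1) h Tu] Tu])
    fix x :: "complex vec" assume x: "x \<in> carrier_vec d"
    have hx: "\<rho> (inv h) *\<^sub>v x \<in> carrier_vec d" by (rule rep_vec_carrier[OF rep(1) inv_closed[OF h] x])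
    have Tx: "T *\<^sub>v x \<in> carrier_vec d'" using TC x by (rule mult_mat_vec_carrier)
    have "(\<rho> h *\<^sub>v (mat_adjoint T *\<^sub>v u)) \<bullet>c x = u \<bullet>c (T *\<^sub>v (\<rho> (inv h) *\<^sub>v x))"
      using rep_cscalar_prod[OF rep(1) h Tu x] mat_adjoint_cscalar_prod'[OF TC hx uD(1)] by simp
    also have "\<dots> = (\<rho>' h *\<^sub>v u) \<bullet>c (T *\<^sub>v x)"
      using intertwiner_act[OF rep T inv_closed[OF h] x] rep_cscalar_prod[OF rep(2) h uD(1) Tx] by simp
    also have "\<dots> = (mat_adjoint T *\<^sub>v u) \<bullet>c x"
      using mat_adjoint_cscalar_prod'[OF TC x uD(1)] uD(2)[OF h] by simp
    finally show "(\<rho> h *\<^sub>v (mat_adjoint T *\<^sub>v u)) \<bullet>c x = (mat_adjoint T *\<^sub>v u) \<bullet>c x" .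
  qed
  then show ?thesis using Tu unfolding fixed_space_def by simp
qed

text \<open>The matrix coefficient map
  \<open>x \<mapsto> (h \<mapsto> \<langle>x, \<rho> h y\<rangle>)\<close> into functions on the
  group. The conjugate comes from the second slot of \<open>\<bullet>c\<close>; the map is linear in
  \<open>x\<close>.\<close>

definition coefficient_map :: "nat \<Rightarrow> ('h \<Rightarrow> complex mat) \<Rightarrow> complex vec \<Rightarrow> complex mat" where
  "coefficient_map d \<rho> y = mat (Coset.order H) d (\<lambda>(i, j). cnj ((\<rho> (elem_enum H i) *\<^sub>v y) $ j))"

lemma coefficient_map_act:
  assumes rep: "unitary_rep H d \<rho>" and y: "y \<in> carrier_vec d" and x: "x \<in> carrier_vec d"
  shows "coefficient_map d \<rho> y *\<^sub>v x = coord_vec (\<lambda>h. x \<bullet>c (\<rho> h *\<^sub>v y))"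
proof (rule eq_vecI)
  fix i assume "i < dim_vec (coord_vec (\<lambda>h. x \<bullet>c (\<rho> h *\<^sub>v y)))"
  then have i: "i < Coset.order H" unfolding coord_vec_def by simp
  have "\<rho> (elem_enum H i) *\<^sub>v y \<in> carrier_vec d"
    by (rule rep_vec_carrier[OF rep elem_enum_carrier[OF i] y])
  then show "(coefficient_map d \<rho> y *\<^sub>v x) $ i = coord_vec (\<lambda>h. x \<bullet>c (\<rho> h *\<^sub>v y)) $ i"
    using i x rep_carrier[OF rep elem_enum_carrier[OF i]] unfolding coefficient_map_def coord_vec_def
    by (auto simp: scalar_prod_def mult.commute intro!: sum.cong)
qed (simp add: coefficient_map_def coord_vec_def)

lemma intertwiner_coefficient_map:
  assumes rep: "unitary_rep H d \<rho>" and y: "y \<in> carrier_vec d"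
  shows "intertwiner H d \<rho> (Coset.order H) (reg_rep H) (coefficient_map d \<rho> y)"
  unfolding intertwiner_def
proof (intro conjI ballI)
  let ?T = "coefficient_map d \<rho> y"
  show T: "?T \<in> carrier_mat (Coset.order H) d" unfolding coefficient_map_def by simp
  fix h assume h: "h \<in> carrier H"
  show "?T * \<rho> h = reg_rep H h * ?T"
  proof (rule mat_eq_mult_vecI[OF mult_carrier_mat[OF T rep_carrier[OF rep h]]
        mult_carrier_mat[OF reg_rep_carrier T]])
    fix u :: "complex vec" assume u: "u \<in> carrier_vec d"
    have "(\<rho> h *\<^sub>v u) \<bullet>c (\<rho> x *\<^sub>v y) = u \<bullet>c (\<rho> (inv h \<otimes> x) *\<^sub>v y)" if x: "x \<in> carrier H" for x
      using rep_cscalar_prod[OF rep h u rep_vec_carrier[OF rep x y]]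
        rep_act[OF rep inv_closed[OF h] x y] by simp
    then have "?T *\<^sub>v (\<rho> h *\<^sub>v u) = reg_rep H h *\<^sub>v (?T *\<^sub>v u)"
      using h coefficient_map_act[OF rep y u]
        coefficient_map_act[OF rep y rep_vec_carrier[OF rep h u]]
      by (simp add: reg_rep_coord_vec) (auto intro!: coord_vec_cong)
    then show "(?T * \<rho> h) *\<^sub>v u = (reg_rep H h * ?T) *\<^sub>v u"
      using assoc_mult_mat_vec[OF T rep_carrier[OF rep h] u]
        assoc_mult_mat_vec[OF reg_rep_carrier T u] by simp
  qed
qed

text \<open>An eigenvector \<open>x\<close> of \<open>\<rho>\<close> is carried into the regular
  representation by its own coefficient map. The image takes the value
  \<open>\<langle>x, x\<rangle>\<close> at \<open>\<one>\<close> and so is non-zero; hence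
  \<open>l\<close> occurs there, and \<open>least\<close> supplies minimality.\<close>

lemma psi_reg_eqI:
  assumes rep: "unitary_rep H d \<rho>" and triv: "fixed_space (carrier H) d \<rho> = {0\<^sub>v d}"
    and l: "l \<in> real_eigenvalues (ga_rep H d \<rho> (ga_Delta H w))"
    and least: "\<And>u m. u \<in> orth_compl (Coset.order H) (fixed_space (carrier H) (Coset.order H) (reg_rep H)) \<Longrightarrow>
      eigenvector (ga_rep H (Coset.order H) (reg_rep H) (ga_Delta H w)) u (complex_of_real m) \<Longrightarrow> l \<le> m"
  shows "psi_reg H w = ereal l"
proof -
  let ?N = "Coset.order H"
  let ?F = "fixed_space (carrier H) ?N (reg_rep H)"
  let ?A = "ga_rep H ?N (reg_rep H) (ga_Delta H w)"
  obtain x where ev: "eigenvector (ga_rep H d \<rho> (ga_Delta H w)) x (complex_of_real l)"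
    using l unfolding real_eigenvalues_def by blast
  then have x: "x \<in> carrier_vec d" "x \<noteq> 0\<^sub>v d"
    using ga_rep_carrier[of d \<rho> "ga_Delta H w"] unfolding eigenvector_def by auto
  let ?T = "coefficient_map d \<rho> x"
  note T = intertwiner_coefficient_map[OF rep x(1)]
  then have TC: "?T \<in> carrier_mat ?N d" unfolding intertwiner_def by simp
  have Tx: "?T *\<^sub>v x \<in> carrier_vec ?N" using TC x(1) by (rule mult_mat_vec_carrier)
  have Tx0: "?T *\<^sub>v x \<noteq> 0\<^sub>v ?N"
  proof
    assume "?T *\<^sub>v x = 0\<^sub>v ?N"
    also have "0\<^sub>v ?N = coord_vec (\<lambda>_. 0)" unfolding coord_vec_def by auto
    finally have "coord_vec (\<lambda>h. x \<bullet>c (\<rho> h *\<^sub>v x)) = coord_vec (\<lambda>_. 0)"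
      unfolding coefficient_map_act[OF rep x(1) x(1)] .
    then have "x \<bullet>c (\<rho> \<one> *\<^sub>v x) = 0"
      by (rule coord_vec_inject[OF _ one_closed])
    then show False using x rep_one_act[OF rep x(1)] by simp
  qed
  have orth: "?T *\<^sub>v x \<in> orth_compl ?N ?F"
  proof -
    have "(?T *\<^sub>v x) \<bullet>c u = 0" if u: "u \<in> ?F" for u
    proof -
      have "mat_adjoint ?T *\<^sub>v u = 0\<^sub>v d"
        using intertwiner_adjoint_fixed[OF rep unitary_reg_rep T u] triv by blast
      then show ?thesis
        using mat_adjoint_cscalar_prod[OF TC x(1) fixed_spaceD(1)[OF u]] x(1) by simp
    qed
    then show ?thesis using Tx unfolding orth_compl_def by simp
  qed
  have "?F \<noteq> carrier_vec ?N"
  proof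
    assume "?F = carrier_vec ?N"
    then have "(?T *\<^sub>v x) \<bullet>c (?T *\<^sub>v x) = 0"
      using orth Tx unfolding orth_compl_def by blast
    then show False using Tx0 Tx by simp
  qed
  moreover have "Min {m. \<exists>v\<in>orth_compl ?N ?F. eigenvector ?A v (complex_of_real m)} = l"
  proof (rule Min_eqI)
    show "finite {m. \<exists>v\<in>orth_compl ?N ?F. eigenvector ?A v (complex_of_real m)}"
      by (rule finite_subset[OF _ finite_real_eigenvalues[OF ga_rep_carrier]])
        (auto simp: real_eigenvalues_def)
    show "l \<in> {m. \<exists>v\<in>orth_compl ?N ?F. eigenvector ?A v (complex_of_real m)}"
      using orth intertwiner_eigenvector[OF rep unitary_reg_rep T ev Tx0] by blast
  qed (use least in blast)
  ultimately show ?thesis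
    unfolding psi_reg_def psi_def by simp
qed

text \<open>The operator \<open>\<Sum> \<rho> h\<close> takes its values in the fixed vectors, to
  which \<open>u\<close> is orthogonal.\<close>

lemma sum_rep_orthogonal_fixed:
  assumes rep: "unitary_rep H d \<rho>" and u: "u \<in> orth_compl d (fixed_space (carrier H) d \<rho>)"
  shows "(\<Sum>h\<in>carrier H. (\<rho> h *\<^sub>v u) \<bullet>c u) = 0"
proof -
  have uC: "u \<in> carrier_vec d" using u unfolding orth_compl_def by simp
  let ?P = "msum d d \<rho> (carrier H)"
  have P: "(?P *\<^sub>v u) \<bullet>c y = (\<Sum>h\<in>carrier H. (\<rho> h *\<^sub>v u) \<bullet>c y)" if "y \<in> carrier_vec d" for y
    using rep_carrier[OF rep] uC that by (intro msum_cscalar_prod)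
  have Pu: "?P *\<^sub>v u \<in> carrier_vec d" using msum_carrier uC by (rule mult_mat_vec_carrier)
  have "\<rho> k *\<^sub>v (?P *\<^sub>v u) = ?P *\<^sub>v u" if k: "k \<in> carrier H" for k
  proof (rule vec_eq_cscalar_prodI[OF rep_vec_carrier[OF rep k Pu] Pu])
    fix y :: "complex vec" assume y: "y \<in> carrier_vec d"
    have "(\<rho> k *\<^sub>v (?P *\<^sub>v u)) \<bullet>c y = (\<Sum>h\<in>carrier H. (\<rho> h *\<^sub>v u) \<bullet>c (\<rho> (inv k) *\<^sub>v y))"
      using rep_cscalar_prod[OF rep k Pu y] P[OF rep_vec_carrier[OF rep inv_closed[OF k] y]] by simp
    also have "\<dots> = (\<Sum>h\<in>carrier H. (\<rho> (k \<otimes> h) *\<^sub>v u) \<bullet>c y)"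
      using rep_act[OF rep k _ uC] rep_cscalar_prod[OF rep k rep_vec_carrier[OF rep _ uC] y]
      by (intro sum.cong refl) simp
    also have "\<dots> = (\<Sum>h\<in>carrier H. (\<rho> h *\<^sub>v u) \<bullet>c y)"
      by (rule sum.reindex_bij_witness[of _ "\<lambda>h. inv k \<otimes> h" "\<lambda>h. k \<otimes> h"])
        (use k in \<open>auto simp: m_assoc[symmetric]\<close>)
    finally show "(\<rho> k *\<^sub>v (?P *\<^sub>v u)) \<bullet>c y = (?P *\<^sub>v u) \<bullet>c y" using P[OF y] by simp
  qed
  then have "?P *\<^sub>v u \<in> fixed_space (carrier H) d \<rho>"
    using Pu unfolding fixed_space_def by simp
  then have "u \<bullet>c (?P *\<^sub>v u) = 0" using u unfolding orth_compl_def by simp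
  then have "(?P *\<^sub>v u) \<bullet>c u = 0" using cscalar_prod_cnj[OF uC Pu] by simp
  then show ?thesis using P[OF uC] by simp
qed

text \<open>Averaging the rank one map \<open>z \<mapsto> \<langle>z, u\<rangle> x\<close> gives an
  intertwiner, and the sum is its coefficient at \<open>u\<close> and \<open>x\<close>. The
  hypothesis \<open>no\<close> concerns one vector rather than a pair of disjoint representations,
  so it can be applied to a single \<open>u\<close> inside the regular representation.\<close>

lemma matrix_coefficients_orthogonal:
  assumes rep: "unitary_rep H d \<rho>" "unitary_rep H d' \<rho>'"
    and u: "u \<in> carrier_vec d" and x: "x \<in> carrier_vec d'"
    and no: "\<And>T. intertwiner H d \<rho> d' \<rho>' T \<Longrightarrow> T *\<^sub>v u = 0\<^sub>v d'"
  shows "(\<Sum>h\<in>carrier H. ((\<rho> h *\<^sub>v u) \<bullet>c u) * cnj ((\<rho>' h *\<^sub>v x) \<bullet>c x)) = 0"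
proof -
  let ?A = "mat d' d (\<lambda>(i, j). x $ i * cnj (u $ j))"
  have A: "?A \<in> carrier_mat d' d" by simp
  have Az: "?A *\<^sub>v z = (z \<bullet>c u) \<cdot>\<^sub>v x" if "z \<in> carrier_vec d" for z
    using that u x by (intro eq_vecI) (auto simp: scalar_prod_def sum_distrib_left mult_ac intro!: sum.cong)
  have "(averaged d \<rho> d' \<rho>' ?A *\<^sub>v u) \<bullet>c x = 0"
    using no[OF intertwiner_averaged[OF rep A]] x by simp
  then have "(\<Sum>h\<in>carrier H. (?A *\<^sub>v (\<rho> h *\<^sub>v u)) \<bullet>c (\<rho>' h *\<^sub>v x)) = 0"
    unfolding averaged_cscalar_prod[OF rep A u x] .
  moreover have "(?A *\<^sub>v (\<rho> h *\<^sub>v u)) \<bullet>c (\<rho>' h *\<^sub>v x)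
      = ((\<rho> h *\<^sub>v u) \<bullet>c u) * cnj ((\<rho>' h *\<^sub>v x) \<bullet>c x)" if h: "h \<in> carrier H" for h
  proof -
    note C = rep_vec_carrier[OF rep(1) h u] rep_vec_carrier[OF rep(2) h x]
    show ?thesis
      unfolding Az[OF C(1)] cscalar_prod_smult_left[OF x C(2)] cscalar_prod_cnj[OF C(2) x] ..
  qed
  ultimately show ?thesis by simp
qed

end

section \<open>Complemented subgroups\<close>

text \<open>\<open>B\<close> stands for \<open>G^n\<close> and \<open>S\<close> for the symmetric
  group inside the wreath product. The estimates draw on the unique factorisation
  \<open>b \<otimes> s\<close> and on the generation of \<open>S\<close> by the involutions
  \<open>\<tau> i\<close>, which are the transpositions.\<close>

locale complemented_subgroups = finite_group H for H :: "'h monoid" (structure) +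
  fixes B S :: "'h set" and I :: "'i set" and \<tau> :: "'i \<Rightarrow> 'h"
  assumes B: "subgroup B H" and S: "subgroup S H"
    and factor: "bij_betw (\<lambda>(b, s). b \<otimes> s) (B \<times> S) (carrier H)"
    and finite_I: "finite I" and \<tau>_mem: "\<And>i. i \<in> I \<Longrightarrow> \<tau> i \<in> S"
    and \<tau>_inv: "\<And>i. i \<in> I \<Longrightarrow> inv (\<tau> i) = \<tau> i"
    and S_generated: "S \<subseteq> generate H (\<tau> ` I)"
begin

lemma B_carrier: "b \<in> B \<Longrightarrow> b \<in> carrier H"
  using subgroup.mem_carrier[OF B] .

lemma S_carrier: "s \<in> S \<Longrightarrow> s \<in> carrier H"
  using subgroup.mem_carrier[OF S] .

lemma \<tau>_carrier: "i \<in> I \<Longrightarrow> \<tau> i \<in> carrier H"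
  using S_carrier \<tau>_mem by blast

lemma finite_B: "finite B" and finite_S: "finite S"
  using finite_carrier subgroup.subset[OF B] subgroup.subset[OF S] by (auto intro: finite_subset)

lemma card_S_pos: "0 < card S"
  using finite_S subgroup.one_closed[OF S] by (auto simp: card_gt_0_iff)

lemma sum_factor:
  fixes F :: "'h \<Rightarrow> complex"
  shows "(\<Sum>h\<in>carrier H. F h) = (\<Sum>b\<in>B. \<Sum>s\<in>S. F (b \<otimes> s))"
  using sum.reindex_bij_betw[OF factor, of F] by (simp add: sum.cartesian_product case_prod_beta)

definition element :: "real \<Rightarrow> ('h \<Rightarrow> real) \<Rightarrow> 'h \<Rightarrow> real" where
  "element M c x = (\<Sum>i\<in>I. M * ga_basis (\<tau> i) x) + (\<Sum>b\<in>B. c b * ga_basis b x)"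

lemma element_inv:
  assumes c: "\<And>b. b \<in> B \<Longrightarrow> c (inv b) = c b" and h: "h \<in> carrier H"
  shows "element M c (inv h) = element M c h"
proof -
  have "ga_basis (\<tau> i) (inv h) = ga_basis (\<tau> i) h" if "i \<in> I" for i
    using \<tau>_inv[OF that] \<tau>_carrier[OF that] h unfolding ga_basis_def by (metis inv_inv)
  moreover have "(\<Sum>b\<in>B. c b * ga_basis b (inv h)) = (\<Sum>b\<in>B. c b * ga_basis b h)"
  proof (rule sum.reindex_bij_witness[of _ "\<lambda>b. inv b" "\<lambda>b. inv b"])
    fix b assume b: "b \<in> B"
    show "inv b \<in> B" "inv (inv b) = b"
      using subgroup.m_inv_closed[OF B b] B_carrier[OF b] by auto
    show "c (inv b) * ga_basis (inv b) h = c b * ga_basis b (inv h)"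
      using c[OF b] B_carrier[OF b] h unfolding ga_basis_def by (metis inv_inv)
  qed (use subgroup.m_inv_closed[OF B] B_carrier in auto)
  ultimately show ?thesis unfolding element_def by simp
qed

lemma sum_element:
  fixes F :: "'h \<Rightarrow> complex"
  shows "(\<Sum>h\<in>carrier H. complex_of_real (element M c h) * F h)
    = complex_of_real M * (\<Sum>i\<in>I. F (\<tau> i)) + (\<Sum>b\<in>B. complex_of_real (c b) * F b)"
proof -
  have basis: "(\<Sum>x\<in>carrier H. complex_of_real (ga_basis h x) * F x) = F h" if "h \<in> carrier H" for h
    using that finite_carrier unfolding ga_basis_def
    by (simp add: if_distrib[of complex_of_real] if_distrib[of "\<lambda>z. z * _"] cong: if_cong)
  have "(\<Sum>h\<in>carrier H. complex_of_real (element M c h) * F h)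
      = (\<Sum>h\<in>carrier H. \<Sum>i\<in>I. complex_of_real M * (complex_of_real (ga_basis (\<tau> i) h) * F h))
      + (\<Sum>h\<in>carrier H. \<Sum>b\<in>B. complex_of_real (c b) * (complex_of_real (ga_basis b h) * F h))"
    unfolding element_def
    by (simp add: sum_distrib_right distrib_right sum.distrib mult.assoc)
  also have "\<dots> = (\<Sum>i\<in>I. complex_of_real M * F (\<tau> i)) + (\<Sum>b\<in>B. complex_of_real (c b) * F b)"
    unfolding sum.swap[of _ I] sum.swap[of _ B] sum_distrib_left[symmetric]
    by (intro arg_cong2[of _ _ _ _ "(+)"] sum.cong refl) (simp_all add: basis \<tau>_carrier B_carrier)
  finally show ?thesis by (simp add: sum_distrib_left)
qed

section \<open>Displacement by the generators controls displacement by all of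
  \<open>S\<close>\<close>

definition displacement :: "('h \<Rightarrow> complex mat) \<Rightarrow> complex vec \<Rightarrow> real" where
  "displacement \<rho> u = (\<Sum>i\<in>I. (vnorm (u - \<rho> (\<tau> i) *\<^sub>v u))\<^sup>2)"

lemma displacement_nonneg: "0 \<le> displacement \<rho> u"
  unfolding displacement_def by (simp add: sum_nonneg)

text \<open>Expanding the square, with \<open>\<rho> h\<close> an isometry, turns a term of the
  Laplacian into half a squared displacement; this half is the one in the coefficient
  \<open>M / 2\<close> of the quadratic form.\<close>

lemma vnorm_minus_rep:
  assumes rep: "unitary_rep H d \<rho>" and h: "h \<in> carrier H" and u: "u \<in> carrier_vec d"
  shows "(vnorm (u - \<rho> h *\<^sub>v u))\<^sup>2 = 2 * ((vnorm u)\<^sup>2 - Re ((\<rho> h *\<^sub>v u) \<bullet>c u))"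
proof -
  note hu = rep_vec_carrier[OF rep h u]
  have "(u - \<rho> h *\<^sub>v u) \<bullet>c (u - \<rho> h *\<^sub>v u)
      = u \<bullet>c u - cnj ((\<rho> h *\<^sub>v u) \<bullet>c u) - ((\<rho> h *\<^sub>v u) \<bullet>c u - (\<rho> h *\<^sub>v u) \<bullet>c (\<rho> h *\<^sub>v u))"
    using u hu cscalar_prod_cnj[OF hu u]
    by (simp add: cscalar_prod_minus_left[of _ d] cscalar_prod_minus_right[of _ d])
  then have "complex_of_real ((vnorm (u - \<rho> h *\<^sub>v u))\<^sup>2)
      = complex_of_real (2 * ((vnorm u)\<^sup>2 - Re ((\<rho> h *\<^sub>v u) \<bullet>c u)))"
    unfolding cscalar_prod_self rep_vnorm[OF rep h u]
    by (simp add: complex_eq_iff)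
  then show ?thesis by (simp only: of_real_eq_iff)
qed

lemma displacement_generator:
  assumes "i \<in> I"
  shows "vnorm (u - \<rho> (\<tau> i) *\<^sub>v u) \<le> sqrt (displacement \<rho> u)"
proof -
  have "(vnorm (u - \<rho> (\<tau> i) *\<^sub>v u))\<^sup>2 \<le> displacement \<rho> u"
    unfolding displacement_def using assms finite_I by (intro member_le_sum) auto
  then show ?thesis by (simp add: real_le_rsqrt)
qed

text \<open>Induction on words in the generators: \<open>u - h k u\<close> is the sum of
  \<open>u - h u\<close> and \<open>h (u - k u)\<close>, and \<open>h\<close> is an isometry.
  \<open>N\<close> stands outside the quantifiers over representations, since one \<open>M\<close>
  has to serve all of them.\<close>

lemma displacement_bound_elem:
  assumes "s \<in> generate H (\<tau> ` I)"
  shows "\<exists>N\<ge>0. \<forall>d \<rho> u. unitary_rep H d \<rho> \<longrightarrow> u \<in> carrier_vec d \<longrightarrow>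
    vnorm (u - \<rho> s *\<^sub>v u) \<le> N * sqrt (displacement \<rho> u)"
  using assms
proof (induction s rule: generate.induct)
  case one
  have "vnorm (u - \<rho> \<one> *\<^sub>v u) \<le> 0 * sqrt (displacement \<rho> u)"
    if "unitary_rep H d \<rho>" "u \<in> carrier_vec d" for d \<rho> and u :: "complex vec"
  proof -
    have "u - \<rho> \<one> *\<^sub>v u = 0\<^sub>v d" using rep_one_act[OF that] that(2) by simp
    then show ?thesis using vnorm_pos_iff[of "0\<^sub>v d" d] by auto
  qed
  then show ?case by blast
next
  case (incl h)
  then obtain i where "i \<in> I" "h = \<tau> i" by blast
  then show ?case using displacement_generator by (intro exI[of _ 1]) auto
next
  case (inv h)
  then obtain i where "i \<in> I" "h = \<tau> i" by blast
  then show ?case using displacement_generator \<tau>_inv by (intro exI[of _ 1]) auto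
next
  case (eng h k)
  obtain N where N: "0 \<le> N" "\<And>d \<rho> u. unitary_rep H d \<rho> \<Longrightarrow> u \<in> carrier_vec d \<Longrightarrow>
    vnorm (u - \<rho> h *\<^sub>v u) \<le> N * sqrt (displacement \<rho> u)"
    using eng.IH(1) by blast
  obtain N' where N': "0 \<le> N'" "\<And>d \<rho> u. unitary_rep H d \<rho> \<Longrightarrow> u \<in> carrier_vec d \<Longrightarrow>
    vnorm (u - \<rho> k *\<^sub>v u) \<le> N' * sqrt (displacement \<rho> u)"
    using eng.IH(2) by blast
  have gen: "generate H (\<tau> ` I) \<subseteq> carrier H"
    using \<tau>_carrier by (intro generate_incl) auto
  then have h: "h \<in> carrier H" and k: "k \<in> carrier H" using eng.hyps by auto
  have "vnorm (u - \<rho> (h \<otimes> k) *\<^sub>v u) \<le> (N + N') * sqrt (displacement \<rho> u)"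
    if rep: "unitary_rep H d \<rho>" and u: "u \<in> carrier_vec d" for d \<rho> and u :: "complex vec"
  proof -
    note C = rep_vec_carrier[OF rep h u] rep_vec_carrier[OF rep k u]
    note hku = rep_vec_carrier[OF rep h C(2)]
    have "\<rho> h *\<^sub>v u - \<rho> h *\<^sub>v (\<rho> k *\<^sub>v u) = \<rho> h *\<^sub>v (u - \<rho> k *\<^sub>v u)"
      using mult_minus_distrib_mat_vec[OF rep_carrier[OF rep h] u C(2)] by simp
    then have "vnorm (\<rho> h *\<^sub>v u - \<rho> h *\<^sub>v (\<rho> k *\<^sub>v u)) = vnorm (u - \<rho> k *\<^sub>v u)"
      using rep_vnorm[OF rep h] u C(2) by simp
    moreover have "vnorm (u - \<rho> h *\<^sub>v (\<rho> k *\<^sub>v u))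
        \<le> vnorm (u - \<rho> h *\<^sub>v u) + vnorm (\<rho> h *\<^sub>v u - \<rho> h *\<^sub>v (\<rho> k *\<^sub>v u))"
      by (rule vnorm_triangle_minus[OF u C(1) hku])
    ultimately show ?thesis
      using N(2)[OF rep u] N'(2)[OF rep u] rep_act[OF rep h k u] by (simp add: distrib_right)
  qed
  then show ?case using N(1) N'(1) by (intro exI[of _ "N + N'"]) auto
qed

lemma displacement_bound:
  obtains N where "0 \<le> N" "\<And>d \<rho> u s. unitary_rep H d \<rho> \<Longrightarrow> u \<in> carrier_vec d \<Longrightarrow> s \<in> S \<Longrightarrow>
    vnorm (u - \<rho> s *\<^sub>v u) \<le> N * sqrt (displacement \<rho> u)"
proof -
  have "\<forall>s\<in>S. \<exists>N\<ge>0. \<forall>d \<rho> u. unitary_rep H d \<rho> \<longrightarrow> u \<in> carrier_vec d \<longrightarrow>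
    vnorm (u - \<rho> s *\<^sub>v u) \<le> N * sqrt (displacement \<rho> u)"
    using displacement_bound_elem S_generated by blast
  then obtain N where N: "\<And>s. s \<in> S \<Longrightarrow> 0 \<le> N s" "\<And>s d \<rho> u. s \<in> S \<Longrightarrow> unitary_rep H d \<rho> \<Longrightarrow>
    u \<in> carrier_vec d \<Longrightarrow> vnorm (u - \<rho> s *\<^sub>v u) \<le> N s * sqrt (displacement \<rho> u)"
    by metis
  \<comment> \<open>The constants \<open>N s\<close> are non-negative and \<open>S\<close> is
    finite, so their sum is a common upper bound.\<close>
  show thesis
  proof (rule that[of "\<Sum>s\<in>S. N s"])
    show "0 \<le> (\<Sum>s\<in>S. N s)" using N(1) by (rule sum_nonneg)
    fix d \<rho> s and u :: "complex vec" assume *: "unitary_rep H d \<rho>" "u \<in> carrier_vec d" "s \<in> S"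
    have "vnorm (u - \<rho> s *\<^sub>v u) \<le> N s * sqrt (displacement \<rho> u)" by (rule N(2)[OF *(3,1,2)])
    also have "\<dots> \<le> (\<Sum>s\<in>S. N s) * sqrt (displacement \<rho> u)"
      using *(3) N(1) finite_S displacement_nonneg by (intro mult_right_mono member_le_sum) auto
    finally show "vnorm (u - \<rho> s *\<^sub>v u) \<le> (\<Sum>s\<in>S. N s) * sqrt (displacement \<rho> u)" .
  qed
qed

section \<open>The quadratic form of the element and the bound on its low eigenvalues\<close>

lemma Delta_element_quadratic_form:
  assumes rep: "unitary_rep H d \<rho>" and u: "u \<in> carrier_vec d"
  shows "Re ((ga_rep H d \<rho> (ga_Delta H (element M c)) *\<^sub>v u) \<bullet>c u)
    = M / 2 * displacement \<rho> u + (\<Sum>b\<in>B. c b) * (vnorm u)\<^sup>2 - (\<Sum>b\<in>B. c b * Re ((\<rho> b *\<^sub>v u) \<bullet>c u))"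
proof -
  have "Re ((ga_rep H d \<rho> (ga_Delta H (element M c)) *\<^sub>v u) \<bullet>c u)
      = M * (\<Sum>i\<in>I. (vnorm u)\<^sup>2 - Re ((\<rho> (\<tau> i) *\<^sub>v u) \<bullet>c u))
      + (\<Sum>b\<in>B. c b * ((vnorm u)\<^sup>2 - Re ((\<rho> b *\<^sub>v u) \<bullet>c u)))"
    unfolding ga_Delta_cscalar_prod[OF rep u u] sum_element
    by (simp add: cscalar_prod_self flip: of_real_power)
  also have "(\<Sum>i\<in>I. (vnorm u)\<^sup>2 - Re ((\<rho> (\<tau> i) *\<^sub>v u) \<bullet>c u)) = displacement \<rho> u / 2"
    unfolding displacement_def sum_divide_distrib
    using vnorm_minus_rep[OF rep \<tau>_carrier u] by (intro sum.cong refl) simp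
  finally show ?thesis
    by (simp add: right_diff_distrib sum_subtractf sum_distrib_right)
qed

text \<open>Averaging over \<open>S\<close> turns a sum over \<open>B\<close> with \<open>S\<close>-invariant coefficients into a sum over
  the whole group, at the cost of an error controlled by the displacement.\<close>

lemma sum_B_bound:
  assumes rep: "unitary_rep H d \<rho>" and u: "u \<in> carrier_vec d"
    and c: "\<And>b s. b \<in> B \<Longrightarrow> s \<in> S \<Longrightarrow> c (b \<otimes> s) = c b" "\<And>b. b \<in> B \<Longrightarrow> 0 \<le> c b"
    and vanish: "(\<Sum>h\<in>carrier H. complex_of_real (c h) * ((\<rho> h *\<^sub>v u) \<bullet>c u)) = 0"
    and E: "\<And>s. s \<in> S \<Longrightarrow> vnorm (u - \<rho> s *\<^sub>v u) \<le> E"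
  shows "(\<Sum>b\<in>B. c b * Re ((\<rho> b *\<^sub>v u) \<bullet>c u)) \<le> (\<Sum>b\<in>B. c b) * (E * vnorm u)"
proof -
  define q where "q h = (\<rho> h *\<^sub>v u) \<bullet>c u" for h
  have diff: "cmod (q b - q (b \<otimes> s)) \<le> E * vnorm u" if b: "b \<in> B" and s: "s \<in> S" for b s
  proof -
    note bC = B_carrier[OF b] and sC = S_carrier[OF s]
    note su = rep_vec_carrier[OF rep sC u]
    have us: "u - \<rho> s *\<^sub>v u \<in> carrier_vec d" using u su by simp
    have "q b - q (b \<otimes> s) = (\<rho> b *\<^sub>v (u - \<rho> s *\<^sub>v u)) \<bullet>c u"
      unfolding q_def rep_act[OF rep bC sC u]
        mult_minus_distrib_mat_vec[OF rep_carrier[OF rep bC] u su]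
      by (rule cscalar_prod_minus_left[OF rep_vec_carrier[OF rep bC u] rep_vec_carrier[OF rep bC su] u,
            symmetric])
    also have "cmod \<dots> \<le> vnorm (\<rho> b *\<^sub>v (u - \<rho> s *\<^sub>v u)) * vnorm u"
      by (rule cscalar_prod_Cauchy_Schwarz[OF rep_vec_carrier[OF rep bC us] u])
    also have "\<dots> \<le> E * vnorm u"
      unfolding rep_vnorm[OF rep bC us] using E[OF s] vnorm_nonneg by (intro mult_right_mono) auto
    finally show ?thesis .
  qed
  \<comment> \<open>\<open>c\<close> is constant on each coset \<open>b S\<close>, so it can be
    evaluated at \<open>b\<close> after the group has been factored, while \<open>q\<close> keeps
    its argument \<open>b \<otimes> s\<close>.\<close>
  have "(\<Sum>b\<in>B. \<Sum>s\<in>S. complex_of_real (c b) * q (b \<otimes> s))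
      = (\<Sum>h\<in>carrier H. complex_of_real (c h) * q h)"
    unfolding sum_factor by (intro sum.cong refl) (simp add: c(1))
  then have "(\<Sum>b\<in>B. \<Sum>s\<in>S. complex_of_real (c b) * q (b \<otimes> s)) = 0"
    using vanish unfolding q_def by simp
  \<comment> \<open>Subtracting this zero from \<open>card S\<close> copies of the sum over
    \<open>B\<close> leaves the differences \<open>q b - q (b \<otimes> s)\<close>, which are
    controlled by \<open>diff\<close>.\<close>
  then have "complex_of_nat (card S) * (\<Sum>b\<in>B. complex_of_real (c b) * q b)
      = (\<Sum>b\<in>B. \<Sum>s\<in>S. complex_of_real (c b) * (q b - q (b \<otimes> s)))"
    by (simp add: right_diff_distrib sum_subtractf sum_distrib_left mult_ac)
  then have "card S * cmod (\<Sum>b\<in>B. complex_of_real (c b) * q b)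
      = cmod (\<Sum>b\<in>B. \<Sum>s\<in>S. complex_of_real (c b) * (q b - q (b \<otimes> s)))"
    by (metis norm_mult norm_of_nat)
  also have "\<dots> \<le> (\<Sum>b\<in>B. \<Sum>s\<in>S. c b * (E * vnorm u))"
    using c(2) diff
    by (intro order.trans[OF norm_sum] sum_mono) (auto simp: norm_mult intro!: mult_left_mono)
  also have "\<dots> = card S * ((\<Sum>b\<in>B. c b) * (E * vnorm u))"
    by (simp add: sum_distrib_right sum_distrib_left mult_ac)
  finally have "cmod (\<Sum>b\<in>B. complex_of_real (c b) * q b) \<le> (\<Sum>b\<in>B. c b) * (E * vnorm u)"
    using card_S_pos by simp
  moreover have "(\<Sum>b\<in>B. c b * Re (q b)) = Re (\<Sum>b\<in>B. complex_of_real (c b) * q b)"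
    by simp
  ultimately show ?thesis
    using complex_Re_le_cmod[of "\<Sum>b\<in>B. complex_of_real (c b) * q b"] unfolding q_def by linarith
qed

text \<open>Pairing the eigenvector equation with \<open>u\<close> bounds
  \<open>l * y\<^sup>2\<close> below by a quadratic form in \<open>x\<close>, the square root of the
  displacement, and \<open>y\<close>, the norm of \<open>u\<close>. Its cross term, the error for
  not being \<open>S\<close>-fixed, is absorbed by the \<open>M\<close> term and a little of
  \<open>\<kappa> * y\<^sup>2\<close>.\<close>

lemma eigenvalue_bound:
  assumes rep: "unitary_rep H d \<rho>" and \<kappa>: "0 < \<kappa>"
    and c: "\<And>b s. b \<in> B \<Longrightarrow> s \<in> S \<Longrightarrow> c (b \<otimes> s) = c b" "\<And>b. b \<in> B \<Longrightarrow> 0 \<le> c b"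
    and vanish: "(\<Sum>h\<in>carrier H. complex_of_real (c h) * ((\<rho> h *\<^sub>v u) \<bullet>c u)) = 0"
    and N: "\<And>s. s \<in> S \<Longrightarrow> vnorm (u - \<rho> s *\<^sub>v u) \<le> N * sqrt (displacement \<rho> u)"
    and M: "M = ((\<Sum>b\<in>B. c b) * N)\<^sup>2 / \<kappa>"
    and ev: "eigenvector (ga_rep H d \<rho> (ga_Delta H (element M c))) u (complex_of_real l)"
  shows "(\<Sum>b\<in>B. c b) - \<kappa> < l"
proof -
  define T where "T = (\<Sum>b\<in>B. c b)"
  define x where "x = sqrt (displacement \<rho> u)"
  define y where "y = vnorm u"
  have u: "u \<in> carrier_vec d" "u \<noteq> 0\<^sub>v d"
    and eq: "ga_rep H d \<rho> (ga_Delta H (element M c)) *\<^sub>v u = complex_of_real l \<cdot>\<^sub>v u"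
    using ev ga_rep_carrier[of d \<rho> "ga_Delta H (element M c)"] unfolding eigenvector_def by auto
  have y: "0 < y" using vnorm_pos_iff[OF u(1)] u(2) unfolding y_def by simp
  have x2: "displacement \<rho> u = x\<^sup>2" unfolding x_def using displacement_nonneg by simp
  have "l * y\<^sup>2 = Re ((ga_rep H d \<rho> (ga_Delta H (element M c)) *\<^sub>v u) \<bullet>c u)"
    unfolding eq cscalar_prod_smult_left[OF u(1) u(1)] cscalar_prod_self y_def
    by (simp flip: of_real_power)
  also have "\<dots> = M / 2 * x\<^sup>2 + T * y\<^sup>2 - (\<Sum>b\<in>B. c b * Re ((\<rho> b *\<^sub>v u) \<bullet>c u))"
    unfolding Delta_element_quadratic_form[OF rep u(1)] x2 T_def y_def ..
  also have "\<dots> \<ge> M / 2 * x\<^sup>2 + T * y\<^sup>2 - T * (N * x * y)"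
    using sum_B_bound[OF rep u(1) c vanish N] unfolding T_def x_def y_def by simp
  finally have "M / 2 * x\<^sup>2 + T * y\<^sup>2 - T * (N * x * y) \<le> l * y\<^sup>2" .
  \<comment> \<open>With this \<open>M\<close>, one half of \<open>\<kappa> * y\<^sup>2\<close>
    completes the square; the other half remains and makes the inequality strict.\<close>
  moreover have "M / 2 * x\<^sup>2 - T * (N * x * y) + \<kappa> * y\<^sup>2
      = ((T * N * x - \<kappa> * y)\<^sup>2 + \<kappa>\<^sup>2 * y\<^sup>2) / (2 * \<kappa>)"
    unfolding M T_def[symmetric] using \<kappa> by (simp add: field_simps power2_eq_square)
  moreover have "0 < ((T * N * x - \<kappa> * y)\<^sup>2 + \<kappa>\<^sup>2 * y\<^sup>2) / (2 * \<kappa>)"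
    using \<kappa> y by (intro divide_pos_pos add_nonneg_pos) auto
  ultimately have "(T - \<kappa>) * y\<^sup>2 < l * y\<^sup>2"
    by (simp add: left_diff_distrib)
  then show ?thesis using y unfolding T_def by simp
qed

section \<open>The separating element attached to an \<open>S\<close>-fixed vector\<close>

theorem separating_element:
  assumes irr: "irreducible_rep H d \<rho>" and nt: "\<not> rep_iso H d \<rho> 1 trivial_rep"
    and v: "v \<in> fixed_space S d \<rho>" "v \<noteq> 0\<^sub>v d"
  shows "\<exists>M c. 0 \<le> M \<and> (\<forall>b\<in>B. c b = c (inv b) \<and> 0 \<le> c b) \<and>
    (\<forall>d' \<rho>'. irreducible_rep H d' \<rho>' \<longrightarrow>
      (psi H (element M c) d' \<rho>' = psi_reg H (element M c) \<longleftrightarrow>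
        rep_iso H d' \<rho>' d \<rho> \<or> rep_iso H d' \<rho>' d (dual_rep H \<rho>)))"
proof -
  note rep = irreducible_repD(1)[OF irr] and d_pos = irreducible_repD(2)[OF irr]
  note triv = fixed_space_nontrivial[OF irr nt]
  note vC = fixed_spaceD(1)[OF v(1)] and vS = fixed_spaceD(2)[OF v(1)]
  let ?\<rho>' = "dual_rep H \<rho>"
  note irr' = irreducible_dual_rep[OF irr] and rep' = unitary_dual_rep[OF rep]
  define K where "K = (vnorm v)\<^sup>2"
  have K: "0 < K" using vnorm_pos_iff[OF vC] v(2) unfolding K_def by simp
  define \<phi> where "\<phi> h = (\<rho> h *\<^sub>v v) \<bullet>c v" for h
  define r where "r h = Re (\<phi> h)" for h
  \<comment> \<open>Cauchy-Schwarz gives \<open>\<bar>r h\<bar> \<le> K\<close>, so adding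
    \<open>K\<close> makes the coefficients non-negative. The constant does no harm, since it pairs
    to zero with the matrix coefficient of any vector orthogonal to the fixed space.\<close>
  define c where "c h = K + r h" for h
  define T where "T = (\<Sum>b\<in>B. c b)"
  \<comment> \<open>The gain at \<open>v\<close>: there \<open>\<Sum> c b * r b\<close> equals
    \<open>K * \<Sum> r b + \<Sum> (r b)\<^sup>2\<close>, its first term vanishes, and division by
    \<open>K = |v|\<^sup>2\<close> normalises.\<close>
  define \<kappa> where "\<kappa> = (\<Sum>b\<in>B. (r b)\<^sup>2) / K"

  have \<phi>_inv: "\<phi> (inv h) = cnj (\<phi> h)" if h: "h \<in> carrier H" for h
    using rep_cscalar_prod[OF rep inv_closed[OF h] vC vC] h
      cscalar_prod_cnj[OF rep_vec_carrier[OF rep h vC] vC] unfolding \<phi>_def by simp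
  have \<phi>_S: "\<phi> (h \<otimes> s) = \<phi> h" if "h \<in> carrier H" "s \<in> S" for h s
    using rep_act[OF rep that(1) S_carrier[OF that(2)] vC] vS[OF that(2)] unfolding \<phi>_def by simp
  have r_bound: "\<bar>r h\<bar> \<le> K" if h: "h \<in> carrier H" for h
    using cscalar_prod_Cauchy_Schwarz[OF rep_vec_carrier[OF rep h vC] vC] rep_vnorm[OF rep h vC]
      abs_Re_le_cmod[of "\<phi> h"] unfolding r_def \<phi>_def K_def power2_eq_square by simp
  have c_inv: "c (inv h) = c h" if "h \<in> carrier H" for h
    using \<phi>_inv[OF that] unfolding c_def r_def by simp
  have c_S: "c (b \<otimes> s) = c b" if "b \<in> B" "s \<in> S" for b s
    using \<phi>_S[OF B_carrier[OF that(1)] that(2)] unfolding c_def r_def by simp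
  have c_nonneg: "0 \<le> c b" if "b \<in> B" for b
    using r_bound[OF B_carrier[OF that]] unfolding c_def by simp
  \<comment> \<open>The identity alone contributes \<open>K\<^sup>2\<close> to the sum of squares,
    which keeps \<open>\<kappa>\<close> positive.\<close>
  have "r \<one> = K"
    using rep_one_act[OF rep vC] unfolding r_def \<phi>_def K_def
    by (simp add: cscalar_prod_self flip: of_real_power)
  then have "0 < (\<Sum>b\<in>B. (r b)\<^sup>2)"
    using K finite_B subgroup.one_closed[OF B] by (intro sum_pos2[of _ \<one>]) auto
  then have \<kappa>: "0 < \<kappa>" using K unfolding \<kappa>_def by simp

  obtain N where N: "0 \<le> N" "\<And>d \<rho> u s. unitary_rep H d \<rho> \<Longrightarrow> u \<in> carrier_vec d \<Longrightarrow> s \<in> S \<Longrightarrow>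
    vnorm (u - \<rho> s *\<^sub>v u) \<le> N * sqrt (displacement \<rho> u)"
    by (rule displacement_bound) blast
  define M where "M = (T * N)\<^sup>2 / \<kappa>"
  have "0 \<le> M" using \<kappa> unfolding M_def by simp
  define w where "w = element M c"
  let ?E = "real_eigenvalues (ga_rep H d \<rho> (ga_Delta H w))"
  have w_inv: "w (inv h) = w h" if "h \<in> carrier H" for h
    unfolding w_def using c_inv B_carrier that by (intro element_inv) auto
  have herm: "hermitian e (ga_rep H e \<sigma> (ga_Delta H w))" if "unitary_rep H e \<sigma>" for e \<sigma>
    using that w_inv by (rule hermitian_ga_Delta)
  note finE = finite_real_eigenvalues[OF ga_rep_carrier]
    and neE = hermitian_real_eigenvalues_nonempty

  \<comment> \<open>\<open>\<sigma>\<close> ranges over all unitary representations, so that the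
    regular one and an irreducible one are both covered later.\<close>
  have separation: "\<exists>X. (intertwiner H e \<sigma> d \<rho> X \<or> intertwiner H e \<sigma> d ?\<rho>' X) \<and> X *\<^sub>v u \<noteq> 0\<^sub>v d"
    if \<sigma>: "unitary_rep H e \<sigma>" and u: "u \<in> orth_compl e (fixed_space (carrier H) e \<sigma>)"
      and ev: "eigenvector (ga_rep H e \<sigma> (ga_Delta H w)) u (complex_of_real l)" and l: "l \<le> T - \<kappa>"
    for e \<sigma> u l
  proof (rule ccontr)
    assume no: "\<not> ?thesis"
    have uC: "u \<in> carrier_vec e" using u unfolding orth_compl_def by simp
    define q where "q h = (\<sigma> h *\<^sub>v u) \<bullet>c u" for h
    have cv: "conjugate v \<in> carrier_vec d" using vC by simp
    \<comment> \<open>The dual has the conjugate matrix coefficient at \<open>conjugate v\<close>.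
      Orthogonality to \<open>\<rho>\<close> therefore kills the sum of \<open>q\<close> against
      \<open>cnj \<phi>\<close>, and orthogonality to the dual kills the sum against
      \<open>\<phi>\<close>.\<close>
    have dual: "(?\<rho>' h *\<^sub>v conjugate v) \<bullet>c conjugate v = cnj (\<phi> h)" if h: "h \<in> carrier H" for h
      using dual_rep_act[OF rep h vC] rep_vec_carrier[OF rep h vC] vC
        conjugate_conjugate_sprod[OF rep_vec_carrier[OF rep h vC] cv]
        conjugate_sprod_vec[OF rep_vec_carrier[OF rep h vC] cv]
      unfolding \<phi>_def by simp
    have "(\<Sum>h\<in>carrier H. q h * cnj (\<phi> h)) = 0"
      unfolding q_def \<phi>_def using no by (intro matrix_coefficients_orthogonal[OF \<sigma> rep uC vC]) blast
    moreover have "(\<Sum>h\<in>carrier H. q h * \<phi> h) = 0"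
    proof -
      have "(\<Sum>h\<in>carrier H. q h * cnj ((?\<rho>' h *\<^sub>v conjugate v) \<bullet>c conjugate v)) = 0"
        unfolding q_def using no by (intro matrix_coefficients_orthogonal[OF \<sigma> rep' uC cv]) blast
      then show ?thesis using dual by simp
    qed
    moreover have "(\<Sum>h\<in>carrier H. q h) = 0"
      unfolding q_def by (rule sum_rep_orthogonal_fixed[OF \<sigma> u])
    \<comment> \<open>\<open>Re \<phi>\<close> is half the sum of \<open>\<phi>\<close> and its
      conjugate, so \<open>c\<close> is a combination of the three functions whose sums against
      \<open>q\<close> have just been shown to vanish.\<close>
    moreover have "complex_of_real (c h) * q h
        = complex_of_real K * q h + (q h * \<phi> h + q h * cnj (\<phi> h)) / 2" for h
      unfolding c_def r_def by (simp add: complex_eq_iff algebra_simps)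
    ultimately have "(\<Sum>h\<in>carrier H. complex_of_real (c h) * q h) = 0"
      by (simp add: sum.distrib sum_distrib_left[symmetric] sum_divide_distrib[symmetric])
    then have "T - \<kappa> < l"
      unfolding T_def q_def
      using N(2)[OF \<sigma> uC] ev unfolding w_def
      by (intro eigenvalue_bound[OF \<sigma> \<kappa> c_S c_nonneg]) (auto simp: M_def T_def)
    then show False using l by simp
  qed

  have "\<exists>l u. eigenvector (ga_rep H d \<rho> (ga_Delta H w)) u (complex_of_real l) \<and> l \<le> T - \<kappa>"
  proof (rule hermitian_Rayleigh[OF herm[OF rep] vC v(2)])
    have "displacement \<rho> v = 0"
    proof -
      have "v - v = 0\<^sub>v d" using vC by simp
      then have "vnorm (v - v) = 0"
        using vnorm_pos_iff[of "v - v" d] vnorm_nonneg[of "v - v"] vC by auto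
      then show ?thesis unfolding displacement_def using vS[OF \<tau>_mem] by simp
    qed
    \<comment> \<open>\<open>V\<close> has no non-zero fixed vectors, so \<open>\<phi>\<close> sums
      to zero over the group; being right \<open>S\<close>-invariant, it already does so over
      \<open>B\<close>.\<close>
    moreover have "(\<Sum>b\<in>B. r b) = 0"
    proof -
      have "v \<in> orth_compl d (fixed_space (carrier H) d \<rho>)"
        unfolding triv orth_compl_zero by (rule vC)
      from sum_rep_orthogonal_fixed[OF rep this] have "(\<Sum>h\<in>carrier H. \<phi> h) = 0"
        unfolding \<phi>_def .
      then have "(\<Sum>b\<in>B. \<Sum>s\<in>S. \<phi> (b \<otimes> s)) = 0"
        unfolding sum_factor[of \<phi>] .
      then have "of_nat (card S) * (\<Sum>b\<in>B. \<phi> b) = 0"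
        using \<phi>_S B_carrier by (simp add: sum_distrib_left)
      then have "(\<Sum>b\<in>B. \<phi> b) = 0" using card_S_pos by simp
      then show ?thesis unfolding r_def by (simp flip: Re_sum)
    qed
    ultimately have "Re ((ga_rep H d \<rho> (ga_Delta H w) *\<^sub>v v) \<bullet>c v) = T * K - \<kappa> * K"
      unfolding w_def Delta_element_quadratic_form[OF rep vC] T_def[symmetric] \<phi>_def[symmetric]
        r_def[symmetric] K_def[symmetric]
      using K unfolding \<kappa>_def
      by (simp add: c_def distrib_right sum.distrib sum_distrib_left[symmetric] power2_eq_square)
    then show "Re ((ga_rep H d \<rho> (ga_Delta H w) *\<^sub>v v) \<bullet>c v) \<le> (T - \<kappa>) * (vnorm v)\<^sup>2"
      unfolding K_def by (simp add: left_diff_distrib)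
  qed
  then obtain l where l: "l \<in> ?E" "l \<le> T - \<kappa>"
    unfolding real_eigenvalues_def by blast
  \<comment> \<open>\<open>v\<close> is a trial vector only, so \<open>\<mu>\<close> may lie
    strictly below \<open>T - \<kappa>\<close>. What counts is that it is not above the threshold
    that \<open>separation\<close> needs.\<close>
  define \<mu> where "\<mu> = Min ?E"
  have \<mu>: "\<mu> \<in> ?E" "\<And>m. m \<in> ?E \<Longrightarrow> \<mu> \<le> m" "\<mu> \<le> T - \<kappa>"
    using Min_in[OF finE neE[OF herm[OF rep] d_pos]] Min_le[OF finE]
      order.trans[OF Min_le[OF finE l(1)] l(2)] unfolding \<mu>_def by auto
  note dual_E = real_eigenvalues_dual_rep[OF rep, of "ga_Delta H w"]

  have reg: "psi_reg H w = ereal \<mu>"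
  proof (rule psi_reg_eqI[OF rep triv \<mu>(1)])
    fix u m
    assume u: "u \<in> orth_compl (Coset.order H) (fixed_space (carrier H) (Coset.order H) (reg_rep H))"
      and ev: "eigenvector (ga_rep H (Coset.order H) (reg_rep H) (ga_Delta H w)) u (complex_of_real m)"
    show "\<mu> \<le> m"
    proof (rule ccontr)
      \<comment> \<open>Such an \<open>m\<close> lies below the threshold, so an intertwiner carries
        its eigenvector into \<open>V\<close> or \<open>V\<^sup>*\<close>. There \<open>m\<close>
        would be an eigenvalue below the minimum.\<close>
      assume "\<not> \<mu> \<le> m"
      then have "m \<le> T - \<kappa>" using \<mu>(3) by simp
      then obtain X where X: "intertwiner H (Coset.order H) (reg_rep H) d \<rho> X
          \<or> intertwiner H (Coset.order H) (reg_rep H) d ?\<rho>' X" "X *\<^sub>v u \<noteq> 0\<^sub>v d"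
        using separation[OF unitary_reg_rep u ev] by blast
      then have "m \<in> ?E \<or> m \<in> real_eigenvalues (ga_rep H d ?\<rho>' (ga_Delta H w))"
        using intertwiner_eigenvector[OF unitary_reg_rep rep _ ev]
          intertwiner_eigenvector[OF unitary_reg_rep rep' _ ev]
        unfolding real_eigenvalues_def by blast
      then show False using \<mu>(2) dual_E \<open>\<not> \<mu> \<le> m\<close> by blast
    qed
  qed

  have "psi H w e \<sigma> = ereal \<mu> \<longleftrightarrow> rep_iso H e \<sigma> d \<rho> \<or> rep_iso H e \<sigma> d ?\<rho>'"
    if \<sigma>: "irreducible_rep H e \<sigma>" for e \<sigma>
  proof
    note repS = irreducible_repD(1)[OF \<sigma>] and e_pos = irreducible_repD(2)[OF \<sigma>]
    let ?F = "real_eigenvalues (ga_rep H e \<sigma> (ga_Delta H w))"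
    {
      \<comment> \<open>As \<open>ereal \<mu>\<close> is finite, \<open>\<sigma>\<close> is not
        fixed pointwise. By irreducibility it has no non-zero fixed vector, so \<open>psi\<close> is
        a genuine minimum, attained at some \<open>u\<close> to which \<open>separation\<close>
        applies.\<close>
      assume psi: "psi H w e \<sigma> = ereal \<mu>"
      then have "fixed_space (carrier H) e \<sigma> \<noteq> carrier_vec e"
        unfolding psi_def by auto
      then have trivS: "fixed_space (carrier H) e \<sigma> = {0\<^sub>v e}"
        using fixed_space_irreducible[OF \<sigma>] by blast
      have "\<mu> = Min ?F" using psi psi_eq_Min[OF e_pos trivS, of w] by simp
      then have "\<mu> \<in> ?F" using Min_in[OF finE neE[OF herm[OF repS] e_pos]] by simp
      then obtain u where ev: "eigenvector (ga_rep H e \<sigma> (ga_Delta H w)) u (complex_of_real \<mu>)"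
        unfolding real_eigenvalues_def by blast
      then have u: "u \<in> carrier_vec e"
        using ga_rep_carrier[of e \<sigma> "ga_Delta H w"] unfolding eigenvector_def by auto
      then have "u \<in> orth_compl e (fixed_space (carrier H) e \<sigma>)"
        unfolding trivS orth_compl_zero .
      from separation[OF repS this ev \<mu>(3)]
      show "rep_iso H e \<sigma> d \<rho> \<or> rep_iso H e \<sigma> d ?\<rho>'"
        using Schur_rep_iso[OF \<sigma> irr _ u] Schur_rep_iso[OF \<sigma> irr' _ u] by blast
    }
    assume iso: "rep_iso H e \<sigma> d \<rho> \<or> rep_iso H e \<sigma> d ?\<rho>'"
    have trivS: "fixed_space (carrier H) e \<sigma> = {0\<^sub>v e}"
      using iso rep_iso_fixed_space[OF repS rep _ triv]
        rep_iso_fixed_space[OF repS rep' _ fixed_space_dual_rep[OF rep triv]] by blast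
    have "?F = ?E"
      using iso rep_iso_real_eigenvalues[OF repS rep] rep_iso_real_eigenvalues[OF repS rep'] dual_E
      by blast
    then show "psi H w e \<sigma> = ereal \<mu>"
      using psi_eq_Min[OF e_pos trivS, of w] unfolding \<mu>_def by simp
  qed
  then show ?thesis
    using \<open>0 \<le> M\<close> c_inv B_carrier c_nonneg unfolding reg[symmetric] w_def
    by (intro exI[of _ M] exI[of _ c]) simp
qed

end

section \<open>Wreath products\<close>

context
  fixes G :: "'g monoid" and n :: nat
  assumes group_G: "group G" and finite_G: "finite (carrier G)"
begin

lemma group_base: "group (base_group n G)"
  unfolding base_group_def using group_G by simp

lemma carrier_base: "carrier (base_group n G) = ({1..n} \<rightarrow>\<^sub>E carrier G)"
  unfolding base_group_def by simp

lemma mult_base: "g \<otimes>\<^bsub>base_group n G\<^esub> h = (\<lambda>i\<in>{1..n}. g i \<otimes>\<^bsub>G\<^esub> h i)"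
  by (simp add: base_group_def)

lemma one_base: "\<one>\<^bsub>base_group n G\<^esub> = (\<lambda>i\<in>{1..n}. \<one>\<^bsub>G\<^esub>)"
  by (simp add: base_group_def)

lemma perm_act_id: "i \<in> {1..n} \<Longrightarrow> perm_act n id h i = h i"
  by (simp add: perm_act_def inv_id)

lemma perm_act_one:
  assumes "\<pi> permutes {1..n}" "i \<in> {1..n}"
  shows "perm_act n \<pi> (\<lambda>i\<in>{1..n}. \<one>\<^bsub>G\<^esub>) i = \<one>\<^bsub>G\<^esub>"
  using assms(2) permutes_in_image[OF permutes_inv[OF assms(1)], of i]
  unfolding perm_act_def by (simp only: restrict_apply if_True)

lemma carrier_wreath:
  "x \<in> carrier (wreath n G) \<longleftrightarrow> fst x \<in> ({1..n} \<rightarrow>\<^sub>E carrier G) \<and> snd x permutes {1..n}"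
  by (cases x) (simp add: wreath_def base_group_def sym_group_def)

lemma mult_wreath:
  "(g, \<pi>) \<otimes>\<^bsub>wreath n G\<^esub> (h, \<sigma>) = (\<lambda>i\<in>{1..n}. g i \<otimes>\<^bsub>G\<^esub> perm_act n \<pi> h i, \<pi> \<circ> \<sigma>)"
  by (simp add: wreath_def base_group_def sym_group_def)

lemma one_wreath: "\<one>\<^bsub>wreath n G\<^esub> = (\<lambda>i\<in>{1..n}. \<one>\<^bsub>G\<^esub>, id)"
  by (simp add: wreath_def base_group_def sym_group_def)

lemma perm_act_mem:
  assumes "\<pi> permutes {1..n}" "h \<in> ({1..n} \<rightarrow>\<^sub>E carrier G)" "i \<in> {1..n}"
  shows "perm_act n \<pi> h i \<in> carrier G"
proof -
  have "inv' \<pi> i \<in> {1..n}"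
    using permutes_in_image[OF permutes_inv[OF assms(1)]] assms(3) by blast
  then show ?thesis using assms(2,3) unfolding perm_act_def by auto
qed

lemma group_wreath: "group (wreath n G)"
proof (rule groupI)
  interpret G: group G by (rule group_G)
  show "\<one>\<^bsub>wreath n G\<^esub> \<in> carrier (wreath n G)"
    unfolding carrier_wreath one_wreath by (auto simp: permutes_id)
  fix x assume x: "x \<in> carrier (wreath n G)"
  obtain g \<pi> where gp: "x = (g, \<pi>)" "g \<in> ({1..n} \<rightarrow>\<^sub>E carrier G)" "\<pi> permutes {1..n}"
    using x carrier_wreath by (cases x) auto
  have "(\<lambda>i\<in>{1..n}. (\<lambda>i\<in>{1..n}. \<one>\<^bsub>G\<^esub>) i \<otimes>\<^bsub>G\<^esub> perm_act n id g i) = g"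
    using gp(2) by (intro ext) (auto simp: perm_act_def PiE_iff extensional_def inv_id)
  then show "\<one>\<^bsub>wreath n G\<^esub> \<otimes>\<^bsub>wreath n G\<^esub> x = x"
    unfolding gp(1) one_wreath mult_wreath by (simp only: id_o)
  show "\<exists>y\<in>carrier (wreath n G). y \<otimes>\<^bsub>wreath n G\<^esub> x = \<one>\<^bsub>wreath n G\<^esub>"
  proof (intro bexI)
    \<comment> \<open>Acting by \<open>inv' \<pi>\<close> turns \<open>g\<close> into
      \<open>g \<circ> \<pi>\<close>, which explains the argument \<open>\<pi> i\<close> in the left
      inverse.\<close>
    let ?y = "(\<lambda>i\<in>{1..n}. inv\<^bsub>G\<^esub> (g (\<pi> i)), inv' \<pi>)"
    have mem: "g (\<pi> i) \<in> carrier G" if "i \<in> {1..n}" for i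
      using gp(2) permutes_in_image[OF gp(3)] that by blast
    show "?y \<in> carrier (wreath n G)"
      unfolding carrier_wreath using mem permutes_inv[OF gp(3)] by auto
    show "?y \<otimes>\<^bsub>wreath n G\<^esub> x = \<one>\<^bsub>wreath n G\<^esub>"
      unfolding gp(1) mult_wreath one_wreath
      using mem permutes_inv_o(2)[OF gp(3)] permutes_inv_inv[OF gp(3)]
      by (auto simp: perm_act_def fun_eq_iff)
  qed
  fix y assume y: "y \<in> carrier (wreath n G)"
  obtain h \<sigma> where hs: "y = (h, \<sigma>)" "h \<in> ({1..n} \<rightarrow>\<^sub>E carrier G)" "\<sigma> permutes {1..n}"
    using y carrier_wreath by (cases y) auto
  show "x \<otimes>\<^bsub>wreath n G\<^esub> y \<in> carrier (wreath n G)"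
    unfolding gp(1) hs(1) mult_wreath carrier_wreath
    using gp hs perm_act_mem[OF gp(3) hs(2)] by (auto simp: permutes_compose PiE_iff)
  fix z assume z: "z \<in> carrier (wreath n G)"
  obtain k \<tau> where kt: "z = (k, \<tau>)" "k \<in> ({1..n} \<rightarrow>\<^sub>E carrier G)" "\<tau> permutes {1..n}"
    using z carrier_wreath by (cases z) auto
  \<comment> \<open>The left action law in coordinates, from which associativity follows together
    with associativity in \<open>G\<close>.\<close>
  have act: "perm_act n (\<pi> \<circ> \<sigma>) k i = perm_act n \<sigma> k (inv' \<pi> i)" "inv' \<pi> i \<in> {1..n}"
    if i: "i \<in> {1..n}" for i
  proof -
    show "inv' \<pi> i \<in> {1..n}" using permutes_in_image[OF permutes_inv[OF gp(3)]] i by blast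
    then show "perm_act n (\<pi> \<circ> \<sigma>) k i = perm_act n \<sigma> k (inv' \<pi> i)"
      using i gp(3) hs(3)
      by (simp add: perm_act_def o_inv_distrib[OF permutes_bij permutes_bij])
  qed
  have "perm_act n \<pi> (\<lambda>i\<in>{1..n}. h i \<otimes>\<^bsub>G\<^esub> perm_act n \<sigma> k i) i
      = perm_act n \<pi> h i \<otimes>\<^bsub>G\<^esub> perm_act n (\<pi> \<circ> \<sigma>) k i" if i: "i \<in> {1..n}" for i
    using i act[OF i] by (simp add: perm_act_def)
  then show "x \<otimes>\<^bsub>wreath n G\<^esub> y \<otimes>\<^bsub>wreath n G\<^esub> z = x \<otimes>\<^bsub>wreath n G\<^esub> (y \<otimes>\<^bsub>wreath n G\<^esub> z)"
    unfolding gp(1) hs(1) kt(1) mult_wreath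
    using gp perm_act_mem[OF gp(3) hs(2)] perm_act_mem[OF permutes_compose[OF hs(3) gp(3)] kt(2)]
    by (auto simp: o_assoc PiE_iff G.m_assoc)
qed

lemma finite_group_wreath: "finite_group (wreath n G)"
proof -
  have "carrier (wreath n G) = ({1..n} \<rightarrow>\<^sub>E carrier G) \<times> {\<pi>. \<pi> permutes {1..n}}"
    by (rule Set.set_eqI) (simp only: carrier_wreath mem_Times_iff mem_Collect_eq)
  then have "finite (carrier (wreath n G))"
    using finite_G by (auto intro!: finite_PiE finite_permutations)
  then show ?thesis
    using group_wreath by (intro finite_group.intro finite_group_axioms.intro)
qed

lemma base_emb_hom: "group_hom (base_group n G) (wreath n G) (base_emb n)"
proof (intro group_hom.intro group_hom_axioms.intro homI group_base group_wreath)
  fix g assume g: "g \<in> carrier (base_group n G)"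
  then show "base_emb n g \<in> carrier (wreath n G)"
    unfolding base_emb_def carrier_wreath carrier_base sym_group_one by (simp add: permutes_id)
  fix h
  show "base_emb n (g \<otimes>\<^bsub>base_group n G\<^esub> h) = base_emb n g \<otimes>\<^bsub>wreath n G\<^esub> base_emb n h"
    unfolding base_emb_def mult_wreath mult_base sym_group_one
    by (auto simp only: id_o prod.inject intro!: restrict_ext perm_act_id[symmetric] arg_cong[of _ _ "\<lambda>x. _ \<otimes>\<^bsub>G\<^esub> x"])
qed

lemma perm_emb_hom: "group_hom (sym_group n) (wreath n G) (perm_emb n G)"
proof (intro group_hom.intro group_hom_axioms.intro homI sym_group_is_group group_wreath)
  interpret G: group G by (rule group_G)
  fix \<pi> assume "\<pi> \<in> carrier (sym_group n)"
  then have p: "\<pi> permutes {1..n}" by (simp only: sym_group_carrier)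
  then show "perm_emb n G \<pi> \<in> carrier (wreath n G)"
    unfolding perm_emb_def carrier_wreath one_base by auto
  fix \<sigma>
  have "(\<lambda>i\<in>{1..n}. (\<lambda>i\<in>{1..n}. \<one>\<^bsub>G\<^esub>) i \<otimes>\<^bsub>G\<^esub> perm_act n \<pi> (\<lambda>i\<in>{1..n}. \<one>\<^bsub>G\<^esub>) i)
      = (\<lambda>i\<in>{1..n}. \<one>\<^bsub>G\<^esub>)"
    by (intro restrict_ext) (simp only: perm_act_one[OF p] restrict_apply if_True G.r_one G.one_closed)
  then show "perm_emb n G (\<pi> \<otimes>\<^bsub>sym_group n\<^esub> \<sigma>) = perm_emb n G \<pi> \<otimes>\<^bsub>wreath n G\<^esub> perm_emb n G \<sigma>"
    unfolding perm_emb_def mult_wreath one_base sym_group_mult by simp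
qed

text \<open>The factorisation \<open>(g; \<pi>) = (g; 1)(1; \<pi>)\<close>; its uniqueness can be
  read off from the pair.\<close>

lemma base_emb_mult_perm_emb:
  assumes "g \<in> carrier (base_group n G)"
  shows "base_emb n g \<otimes>\<^bsub>wreath n G\<^esub> perm_emb n G \<pi> = (g, \<pi>)"
proof -
  interpret G: group G by (rule group_G)
  have g: "g \<in> ({1..n} \<rightarrow>\<^sub>E carrier G)" using assms unfolding carrier_base .
  have "(\<lambda>i\<in>{1..n}. g i \<otimes>\<^bsub>G\<^esub> perm_act n id (\<lambda>i\<in>{1..n}. \<one>\<^bsub>G\<^esub>) i) = g"
    by (rule PiE_ext[OF _ g])
      (use g in \<open>auto simp: perm_act_id PiE_iff\<close>)
  then show ?thesis
    unfolding base_emb_def perm_emb_def mult_wreath one_base sym_group_one by simp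
qed

text \<open>Induction along a product of transpositions. The index set lists each transposition
  once, with \<open>i < j\<close>, so the opposite order is turned round by symmetry.\<close>

lemma perm_emb_generate:
  assumes "\<pi> \<in> carrier (sym_group n)"
  shows "perm_emb n G \<pi> \<in> generate (wreath n G)
    ((\<lambda>(i, j). perm_emb n G (Transposition.transpose i j)) ` {(i, j). 1 \<le> i \<and> i < j \<and> j \<le> n})"
    (is "_ \<in> generate _ ?X")
proof -
  interpret P: group_hom "sym_group n" "wreath n G" "perm_emb n G" by (rule perm_emb_hom)
  have "\<pi> permutes {1..n}" "finite {1..n}" using assms by (simp_all add: sym_group_carrier)
  then show ?thesis
  proof (induction rule: permutes_induct)
    case id
    show ?case using P.hom_one unfolding sym_group_one by (simp only: generate.one)
  next
    case (swap a b p)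
    have X: "perm_emb n G (Transposition.transpose i j) \<in> ?X" if "1 \<le> i" "i < j" "j \<le> n" for i j
      using that by (intro image_eqI[of _ _ "(i, j)"]) auto
    have "perm_emb n G (Transposition.transpose a b) \<in> ?X"
    proof (cases "a < b")
      case True
      then show ?thesis using X swap.hyps by simp
    next
      case False
      then show ?thesis using X[of b a] swap.hyps by (simp add: transpose_commute)
    qed
    moreover have "perm_emb n G (Transposition.transpose a b \<circ> p)
        = perm_emb n G (Transposition.transpose a b) \<otimes>\<^bsub>wreath n G\<^esub> perm_emb n G p"
      using P.hom_mult[of "Transposition.transpose a b" p] swap.hyps
      by (simp add: sym_group_carrier sym_group_mult permutes_swap_id)
    ultimately show ?case
      using generate.eng[OF generate.incl swap.IH] by (simp only:)
  qed
qed

text \<open>Elements of the wreath product are literally pairs, so splitting a pair inverts the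
  multiplication map of the factorisation. The generators are their own inverses because a
  transposition squares to the identity.\<close>

lemma complemented_subgroups_wreath:
  "complemented_subgroups (wreath n G) (base_emb n ` carrier (base_group n G))
    (perm_emb n G ` carrier (sym_group n)) {(i, j). 1 \<le> i \<and> i < j \<and> j \<le> n}
    (\<lambda>(i, j). perm_emb n G (Transposition.transpose i j))"
proof (intro complemented_subgroups.intro complemented_subgroups_axioms.intro finite_group_wreath)
  interpret W: group "wreath n G" by (rule group_wreath)
  interpret P: group_hom "sym_group n" "wreath n G" "perm_emb n G" by (rule perm_emb_hom)
  let ?B = "base_emb n ` carrier (base_group n G)" and ?S = "perm_emb n G ` carrier (sym_group n)"
  let ?I = "{(i, j). 1 \<le> i \<and> i < j \<and> j \<le> n}"
  show "subgroup ?B (wreath n G)" by (rule group_hom.img_is_subgroup[OF base_emb_hom])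
  show "subgroup ?S (wreath n G)" by (rule P.img_is_subgroup)
  show "bij_betw (\<lambda>(b, s). b \<otimes>\<^bsub>wreath n G\<^esub> s) (?B \<times> ?S) (carrier (wreath n G))"
  proof (rule bij_betwI[of _ _ _ "\<lambda>(g, \<pi>). (base_emb n g, perm_emb n G \<pi>)"])
    have pair: "base_emb n g \<otimes>\<^bsub>wreath n G\<^esub> perm_emb n G \<pi> = (g, \<pi>)"
      if "g \<in> carrier (base_group n G)" for g \<pi>
      using that by (rule base_emb_mult_perm_emb)
    show "(\<lambda>(b, s). b \<otimes>\<^bsub>wreath n G\<^esub> s) \<in> ?B \<times> ?S \<rightarrow> carrier (wreath n G)"
    proof (rule funcsetI)
      fix x assume "x \<in> ?B \<times> ?S"
      then obtain g \<pi> where "g \<in> carrier (base_group n G)" "\<pi> \<in> carrier (sym_group n)"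
        "x = (base_emb n g, perm_emb n G \<pi>)" by blast
      then show "(\<lambda>(b, s). b \<otimes>\<^bsub>wreath n G\<^esub> s) x \<in> carrier (wreath n G)"
        using W.m_closed[OF group_hom.hom_closed[OF base_emb_hom] P.hom_closed]
        by (simp only: prod.case)
    qed
    show "(\<lambda>(g, \<pi>). (base_emb n g, perm_emb n G \<pi>)) \<in> carrier (wreath n G) \<rightarrow> ?B \<times> ?S"
      unfolding carrier_base by (auto simp only: carrier_wreath sym_group_carrier fst_conv snd_conv)
    show "(\<lambda>(g, \<pi>). (base_emb n g, perm_emb n G \<pi>)) ((\<lambda>(b, s). b \<otimes>\<^bsub>wreath n G\<^esub> s) x) = x"
      if x: "x \<in> ?B \<times> ?S" for x
    proof -
      obtain g \<pi> where "g \<in> carrier (base_group n G)" "x = (base_emb n g, perm_emb n G \<pi>)"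
        using x by blast
      then show ?thesis by (simp only: prod.case pair)
    qed
    show "(\<lambda>(b, s). b \<otimes>\<^bsub>wreath n G\<^esub> s) ((\<lambda>(g, \<pi>). (base_emb n g, perm_emb n G \<pi>)) y) = y"
      if y: "y \<in> carrier (wreath n G)" for y
    proof -
      obtain g \<pi> where g: "y = (g, \<pi>)" by (cases y)
      then have "g \<in> carrier (base_group n G)"
        using y unfolding carrier_base by (simp only: carrier_wreath fst_conv)
      then show ?thesis unfolding g by (simp only: prod.case pair)
    qed
  qed
  show "finite ?I" by (rule finite_subset[of _ "{1..n} \<times> {1..n}"]) auto
  have swap: "Transposition.transpose i j \<in> carrier (sym_group n)" if "(i, j) \<in> ?I" for i j
    using that unfolding sym_group_carrier by (intro permutes_swap_id) auto
  fix p assume p: "p \<in> ?I"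
  obtain i j where ij: "p = (i, j)" by (cases p)
  note C = swap[OF p[unfolded ij]]
  show "(\<lambda>(i, j). perm_emb n G (Transposition.transpose i j)) p \<in> ?S"
    using C unfolding ij by simp
  have "perm_emb n G (Transposition.transpose i j) \<otimes>\<^bsub>wreath n G\<^esub> perm_emb n G (Transposition.transpose i j)
      = \<one>\<^bsub>wreath n G\<^esub>"
    using P.hom_mult[OF C C] P.hom_one by (simp add: sym_group_mult sym_group_one)
  then show "inv\<^bsub>wreath n G\<^esub> ((\<lambda>(i, j). perm_emb n G (Transposition.transpose i j)) p)
      = (\<lambda>(i, j). perm_emb n G (Transposition.transpose i j)) p"
    unfolding ij prod.case by (rule W.inv_equality[OF _ P.hom_closed[OF C] P.hom_closed[OF C]])
next
  show "perm_emb n G ` carrier (sym_group n) \<subseteq> generate (wreath n G)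
    ((\<lambda>(i, j). perm_emb n G (Transposition.transpose i j)) ` {(i, j). 1 \<le> i \<and> i < j \<and> j \<le> n})"
    by (rule image_subsetI) (rule perm_emb_generate)
qed

end

theorem theorem1p4:
  fixes G :: "'g monoid" and n d :: nat
    and \<rho> :: "(nat \<Rightarrow> 'g) \<times> (nat \<Rightarrow> nat) \<Rightarrow> complex mat"
  assumes "group G" and "finite (carrier G)" and "2 \<le> n"
    and "irreducible_rep (wreath n G) d \<rho>"
    and "\<not> rep_iso (wreath n G) d \<rho> 1 trivial_rep"
    and "sym_spherical n G d \<rho>"
  shows "\<exists>(a :: nat \<Rightarrow> nat \<Rightarrow> real) (c :: (nat \<Rightarrow> 'g) \<Rightarrow> real).
    (\<forall>i j. 1 \<le> i \<and> i < j \<and> j \<le> n \<longrightarrow> 0 \<le> a i j) \<and>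
    (\<forall>g\<in>carrier (base_group n G). c g = c (inv\<^bsub>base_group n G\<^esub> g) \<and> 0 \<le> c g) \<and>
    (\<forall>d' \<rho>'. irreducible_rep (wreath n G) d' \<rho>' \<longrightarrow>
      (psi (wreath n G) (wreath_element n G a c) d' \<rho>'
          = psi_reg (wreath n G) (wreath_element n G a c)
        \<longleftrightarrow> rep_iso (wreath n G) d' \<rho>' d \<rho>
          \<or> rep_iso (wreath n G) d' \<rho>' d (dual_rep (wreath n G) \<rho>)))"
proof -
  let ?W = "wreath n G" and ?B = "carrier (base_group n G)"
  interpret complemented_subgroups ?W "base_emb n ` ?B" "perm_emb n G ` carrier (sym_group n)"
    "{(i, j). 1 \<le> i \<and> i < j \<and> j \<le> n}" "\<lambda>(i, j). perm_emb n G (Transposition.transpose i j)"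
    using assms(1,2) by (rule complemented_subgroups_wreath)
  interpret E: group_hom "base_group n G" ?W "base_emb n"
    using assms(1,2) by (rule base_emb_hom)
  obtain v where "v \<in> fixed_space (perm_emb n G ` carrier (sym_group n)) d \<rho>" "v \<noteq> 0\<^sub>v d"
    using assms(6) unfolding sym_spherical_def by blast
  from separating_element[OF assms(4,5) this] obtain M c where M: "0 \<le> M"
    and c: "\<And>b. b \<in> base_emb n ` ?B \<Longrightarrow> c b = c (inv\<^bsub>?W\<^esub> b) \<and> 0 \<le> c b"
    and psi: "\<And>d' \<rho>'. irreducible_rep ?W d' \<rho>' \<Longrightarrow>
      psi ?W (element M c) d' \<rho>' = psi_reg ?W (element M c) \<longleftrightarrow>
        rep_iso ?W d' \<rho>' d \<rho> \<or> rep_iso ?W d' \<rho>' d (dual_rep ?W \<rho>)"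
    by blast
  have "inj_on (base_emb n) ?B"
    unfolding base_emb_def by (rule inj_onI) simp
  \<comment> \<open>\<open>element\<close> sums over the image of the base group and
    \<open>wreath_element\<close> over the base group itself. Injectivity of the embedding reindexes
    one sum into the other, with \<open>c\<close> composed with \<open>base_emb n\<close>.\<close>
  then have w: "wreath_element n G (\<lambda>_ _. M) (\<lambda>g. c (base_emb n g)) = element M c"
    unfolding wreath_element_def element_def
    by (intro ext) (simp add: sum.reindex case_prod_beta)
  have c': "c (base_emb n g) = c (base_emb n (inv\<^bsub>base_group n G\<^esub> g))" "0 \<le> c (base_emb n g)"
    if "g \<in> ?B" for g
    using c[OF imageI[OF that]] E.hom_inv[OF that] by auto
  show ?thesis
    by (intro exI[of _ "\<lambda>_ _. M"] exI[of _ "\<lambda>g. c (base_emb n g)"] conjI allI impI ballI c' M)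
      (unfold w, assumption, assumption, rule psi)
qed

end
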